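(* Let $T$ be any tree of order $n$ and diameter $4$, and let $P_n$ and $S_n$ be the path and the star on $n$ vertices. Then $LE(P_n)\le LE(T)\le LE(S_n)$.
   Context: For a graph $G$ with $n$ vertices and $m$ edges, let $\mu_1\ge\dots\ge\mu_n$ be the eigenvalues of the Laplacian matrix $L(G)=D(G)-A(G)$ and $\overline{d}=2m/n$. The Laplacian energy is $LE(G)=\sum_{i=1}^n|\mu_i-\overline{d}|$. *)

theory Defs
  imports "Graph_Theory.Graph_Theory" "Jordan_Normal_Form.Char_Poly"
begin

text \<open>
  Simple graphs are the structures satisfying \<^locale>\<open>pair_graph\<close>: a finite vertex set
  \<open>pverts G\<close> with a symmetric irreflexive relation \<open>parcs G\<close>. Each undirected edge is thus
  represented by two opposite arcs.
\<close>

definition edges :: "'a pair_pre_digraph \<Rightarrow> 'a set set" where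
  "edges G = {{u, v} | u v. (u, v) \<in> parcs G}"

text \<open>
  The library predicates \<open>cycle\<close>, \<open>forest\<close> and \<open>tree\<close> are about directed cycles and
  regard a pair of opposite arcs as a cycle, so that no symmetric digraph with an arc is a
  \<open>tree\<close>. Hence cycles of undirected graphs are introduced separately, as
  closed vertex paths on at least three distinct vertices.
\<close>

definition undirected_cycle :: "'a pair_pre_digraph \<Rightarrow> 'a list \<Rightarrow> bool" where
  "undirected_cycle G p \<longleftrightarrow> vpath p (with_proj G) \<and> 3 \<le> length p \<and> (last p, hd p) \<in> parcs G"

definition undirected_tree :: "'a pair_pre_digraph \<Rightarrow> bool" where
  "undirected_tree G \<longleftrightarrow> pair_graph G \<and> Digraph_Component.connected (with_proj G)
     \<and> (\<nexists>p. undirected_cycle G p)"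

text \<open>The library's shortest-path cost with unit weights is the number of edges of a shortest walk.\<close>

definition graph_dist :: "'a pair_pre_digraph \<Rightarrow> 'a \<Rightarrow> 'a \<Rightarrow> ereal" where
  "graph_dist G u v = wf_digraph.\<mu> (with_proj G) (\<lambda>_. 1) u v"

definition diameter :: "'a pair_pre_digraph \<Rightarrow> ereal" where
  "diameter G = (SUP u\<in>pverts G. SUP v\<in>pverts G. graph_dist G u v)"

definition path_graph :: "nat \<Rightarrow> nat pair_pre_digraph" where
  "path_graph n = \<lparr> pverts = {0..<n},
     parcs = {(i, j). i < n \<and> j < n \<and> (j = i + 1 \<or> i = j + 1)} \<rparr>"

text \<open>The centre of the star is the vertex \<open>0\<close>.\<close>

definition star_graph :: "nat \<Rightarrow> nat pair_pre_digraph" where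
  "star_graph n = \<lparr> pverts = {0..<n},
     parcs = {(i, j). i < n \<and> j < n \<and> i \<noteq> j \<and> (i = 0 \<or> j = 0)} \<rparr>"

text \<open>The matrices are taken with respect to a list \<open>vs\<close> enumerating the vertices.\<close>

definition adjacency_mat :: "'a pair_pre_digraph \<Rightarrow> 'a list \<Rightarrow> real mat" where
  "adjacency_mat G vs = mat (length vs) (length vs)
     (\<lambda>(i, j). if (vs ! i, vs ! j) \<in> parcs G then 1 else 0)"

definition degree_mat :: "'a pair_pre_digraph \<Rightarrow> 'a list \<Rightarrow> real mat" where
  "degree_mat G vs = mat (length vs) (length vs)
     (\<lambda>(i, j). if i = j then real (out_degree (with_proj G) (vs ! i)) else 0)"

definition laplacian_mat :: "'a pair_pre_digraph \<Rightarrow> 'a list \<Rightarrow> real mat" where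
  "laplacian_mat G vs = degree_mat G vs - adjacency_mat G vs"

text \<open>
  Eigenvalues with multiplicity, as the multiset of roots of the characteristic polynomial.
  All of its complex roots are real, the matrix being real symmetric, so this multiset
  has as many elements as there are vertices. It does not depend on the enumeration chosen, see
  \<open>laplacian_spectrum_eq\<close> below.
\<close>

definition laplacian_spectrum :: "'a pair_pre_digraph \<Rightarrow> real multiset" where
  "laplacian_spectrum G =
     proots (char_poly (laplacian_mat G (SOME vs. distinct vs \<and> set vs = pverts G)))"

definition average_degree :: "'a pair_pre_digraph \<Rightarrow> real" where
  "average_degree G = 2 * real (card (edges G)) / real (card (pverts G))"

definition laplacian_energy :: "'a pair_pre_digraph \<Rightarrow> real" where
  "laplacian_energy G = (\<Sum>\<mu>\<in>#laplacian_spectrum G. \<bar>\<mu> - average_degree G\<bar>)"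

lemma char_poly_laplacian_mat_cong:
  assumes "distinct vs" "distinct ws" "set vs = set ws"
  shows "char_poly (laplacian_mat G vs) = char_poly (laplacian_mat G ws)"
proof -
  define n where "n = length vs"
  have n: "length ws = n" using assms unfolding n_def by (metis distinct_card)
  have "mset vs = mset ws" using assms by (simp add: set_eq_iff_mset_eq_distinct)
  then obtain p where p: "p permutes {..<n}" and vs: "permute_list p ws = vs"
    using mset_eq_permutation[of vs ws] n by auto
  have nth: "vs ! i = ws ! p i" if "i < n" for i
    using vs permute_list_nth[of p ws i] p n that by auto
  have pn: "p i < n" if "i < n" for i using permutes_in_image[OF p] that by auto
  have inj: "p i = p j \<longleftrightarrow> i = j" for i j using permutes_inj[OF p] by (auto dest: injD)
  let ?L = "laplacian_mat G ws"
  let ?M = "char_poly_matrix ?L"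
  have dim: "?L \<in> carrier_mat n n" "laplacian_mat G vs \<in> carrier_mat n n"
    by (auto simp: laplacian_mat_def degree_mat_def adjacency_mat_def n n_def intro!: minus_carrier_mat)
  then have dimM: "?M \<in> carrier_mat n n" by simp
  have p': "p permutes {0..<n}" using p by (simp add: atLeast0LessThan)
  have eq: "char_poly_matrix (laplacian_mat G vs) = mat n n (\<lambda>(i, j). ?M $$ (p i, p j))"
    using dim by (intro eq_matI)
      (auto simp: char_poly_matrix_def laplacian_mat_def degree_mat_def adjacency_mat_def
        n n_def[symmetric] nth pn inj)
  let ?R = "mat n n (\<lambda>(i, j). ?M $$ (p i, j))"
  have "mat n n (\<lambda>(i, j). ?M $$ (p i, p j))
      = transpose_mat (mat n n (\<lambda>(i, j). transpose_mat ?R $$ (p i, j)))"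
    by (intro eq_matI) (auto simp: pn)
  then have "det (mat n n (\<lambda>(i, j). ?M $$ (p i, p j)))
      = det (mat n n (\<lambda>(i, j). transpose_mat ?R $$ (p i, j)))"
    by (simp add: det_transpose[of _ n])
  also have "\<dots> = signof p * det (transpose_mat ?R)"
    by (rule det_permute_rows[where n = n, OF _ p']) simp
  also have "det (transpose_mat ?R) = det ?R" by (rule det_transpose[of _ n]) simp
  also have "det ?R = signof p * det ?M" by (rule det_permute_rows[OF dimM p'])
  finally show ?thesis unfolding char_poly_def eq
    by (simp add: sign_def split: if_splits)
qed

lemma laplacian_spectrum_eq:
  assumes "distinct vs" "set vs = pverts G"
  shows "laplacian_spectrum G = proots (char_poly (laplacian_mat G vs))"
proof -
  let ?ws = "SOME vs. distinct vs \<and> set vs = pverts G"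
  have "distinct ?ws \<and> set ?ws = pverts G"
    by (rule someI[where x = vs]) (use assms in blast)
  then show ?thesis
    unfolding laplacian_spectrum_def
    using assms char_poly_laplacian_mat_cong[of ?ws vs G] by metis
qed

end

(* Pitfall: HOL-Analysis also has a constant diameter; importing Defs last makes the graph-theoretic
   one take precedence. *)
theory Submission
  imports "HOL-Analysis.Complex_Transcendental" Defs
begin

text \<open>
  A tree of diameter 4 has a centre with \<open>k\<close> neighbours, the \<open>j\<close>-th of which carries \<open>p j\<close> leaves.
  Eliminating leaves and neighbours shows that, up to powers of \<open>x - 1\<close>, its characteristic
  polynomial is that of an arrow matrix whose poles are the roots \<open>alpha (p j) \<le> theta (p j)\<close> of
  \<open>x\<^sup>2 - (p j + 2) * x + 1\<close>. The eigenvalues therefore interlace these poles, and the sign of the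
  secular function at a point decides on which side of it the eigenvalue between two consecutive
  poles lies. Since the deviations \<open>\<mu> - d\<close> from the mean \<open>d = 2 - 2 / n\<close> sum to \<open>0\<close>, the energy is
  twice the sum of the \<open>d - \<mu>\<close> over the eigenvalues \<open>\<mu> < d\<close>, which interlacing bounds from both
  sides. For the upper bound one needs moreover \<open>alpha p \<ge> 1 / (p + 2)\<close> and Cauchy-Schwarz.
  For the lower bound, the eigenvalues \<open>2 - 2 * cos (pi * j / n)\<close> of the path give an energy of about
  \<open>4 * n / pi\<close>, whereas that of the tree is at least about \<open>1.618 * n\<close>; this settles \<open>n \<ge> 7\<close>, and
  \<open>n = 5\<close> (where the tree is the path) and \<open>n = 6\<close> are treated with better bounds on the third
  smallest root.
\<close>

section \<open>Interlacing for arrow matrices\<close>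

text \<open>Of the \<open>2 * k\<close> poles, \<open>k + z\<close> are at most 1 and the remaining
  \<open>r\<close> exceed 2, where \<open>r\<close> neighbours of the centre carry leaves and
  \<open>z\<close> do not. As \<open>d\<close> lies in between, interlacing settles the side of
  \<open>d\<close> for all roots but one, \<open>b (k + z)\<close>. Only this root calls for
  evaluations of the secular function. The star has energy \<open>2 * (n - d)\<close>, from one
  eigenvalue 0 and \<open>n - 2\<close> eigenvalues 1 below \<open>d\<close>, and the upper bound is
  proved in that form. Replacing small roots by the poles before them leaves a sum of values
  \<open>alpha (p j)\<close> that must not be too small; this is why large branches are the obstacle
  and why Cauchy-Schwarz enters. The constant 1.618 is the golden ratio: the lower bound decreases
  in \<open>r\<close>, and in the worst case \<open>r = (n - 1) / 2\<close> about half of the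
  vertices count \<open>1 - alpha 1 = 0.618...\<close> and the other half \<open>t\<close>, which
  tends to 1. The lower-order terms make this bound too weak for \<open>n = 5\<close> and
  \<open>n = 6\<close>; at \<open>n = 7\<close> it holds with little to spare, hence the tight
  numerical constants.\<close>

definition interlaced :: "real list \<Rightarrow> real list \<Rightarrow> bool" where
  "interlaced bs as \<longleftrightarrow> length bs = Suc (length as) \<and>
     (\<forall>i<length as. bs ! i \<le> as ! i \<and> as ! i \<le> bs ! Suc i)"

definition monic_prod :: "real list \<Rightarrow> real poly" where
  "monic_prod xs = (\<Prod>x\<leftarrow>xs. [:- x, 1:])"

lemma monic_prod_simps [simp]:
  "monic_prod [] = 1"
  "monic_prod (x # xs) = [:- x, 1:] * monic_prod xs"
  "monic_prod (xs @ ys) = monic_prod xs * monic_prod ys"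
  by (simp_all add: monic_prod_def)

lemma poly_monic_prod: "poly (monic_prod xs) y = (\<Prod>x\<leftarrow>xs. y - x)"
  by (induction xs) (auto simp: algebra_simps)

lemma monic_prod_neq_0 [simp]: "monic_prod xs \<noteq> 0"
  by (induction xs) (auto simp del: mult_pCons_left)

lemma degree_monic_prod [simp]: "degree (monic_prod xs) = length xs"
  by (induction xs) (auto simp: degree_mult_eq simp del: mult_pCons_left)

lemma lead_coeff_monic_prod [simp]: "coeff (monic_prod xs) (length xs) = 1"
proof -
  have "lead_coeff (monic_prod xs) = 1"
    by (induction xs) (auto simp: lead_coeff_mult simp del: mult_pCons_left)
  then show ?thesis by simp
qed

lemma coeff_monic_prod_subleading:
  "xs \<noteq> [] \<Longrightarrow> coeff (monic_prod xs) (length xs - 1) = - sum_list xs"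
proof (induction xs)
  case (Cons x xs)
  show ?case
  proof (cases xs)
    case (Cons y ys)
    then have "coeff (monic_prod xs) (length xs - 1) = - sum_list xs"
      by (intro Cons.IH) auto
    then show ?thesis
      using Cons lead_coeff_monic_prod[of xs]
      by (simp add: coeff_pCons split: nat.split)
  qed auto
qed auto

lemma poly_monic_prod_at_root: "x \<in> set xs \<Longrightarrow> poly (monic_prod xs) x = 0"
  by (induction xs) auto

lemma proots_monic_prod: "proots (monic_prod xs) = mset xs"
  by (induction xs) (auto simp: proots_mult simp del: mult_pCons_left)

text \<open>Exactly the factors coming from \<open>ys\<close> are negative at
  \<open>y\<close>.\<close>

lemma poly_monic_prod_sign:
  assumes "\<And>x. x \<in> set xs \<Longrightarrow> x < y" "\<And>x. x \<in> set ys \<Longrightarrow> y < x"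
  shows "0 < (-1) ^ length ys * poly (monic_prod (xs @ ys)) y"
proof -
  have "0 < poly (monic_prod xs) y"
    using assms(1) by (induction xs) (auto simp: poly_monic_prod)
  moreover have "0 < (-1) ^ length ys * poly (monic_prod ys) y"
    using assms(2)
  proof (induction ys)
    case (Cons a ys)
    then have "0 < (a - y) * ((-1) ^ length ys * poly (monic_prod ys) y)"
      by (intro mult_pos_pos[of "a - y"]) auto
    also have "\<dots> = (-1) ^ length (a # ys) * poly (monic_prod (a # ys)) y"
      by (simp add: algebra_simps)
    finally show ?case .
  qed auto
  ultimately have "0 < poly (monic_prod xs) y * ((-1) ^ length ys * poly (monic_prod ys) y)"
    by (rule mult_pos_pos)
  then show ?thesis by (simp add: ac_simps)
qed

text \<open>The characteristic polynomial of an arrow matrix with tip \<open>c\<close>, where each pair \<open>(a, w)\<close> is a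
  diagonal entry together with the square of the off-diagonal entry.\<close>

fun arrow_poly :: "real \<Rightarrow> (real \<times> real) list \<Rightarrow> real poly" where
  "arrow_poly c [] = [:- c, 1:]"
| "arrow_poly c ((a, w) # ps) = [:- a, 1:] * arrow_poly c ps - [:w:] * monic_prod (map fst ps)"

text \<open>The recursion is symmetric in the entries, like the determinant behind it. Splitting off
  an inner entry is what allows evaluation at its diagonal value, where only the term with
  \<open>w\<close> survives.\<close>

lemma arrow_poly_remove:
  "arrow_poly c (xs @ (a, w) # ys)
     = [:- a, 1:] * arrow_poly c (xs @ ys) - [:w:] * monic_prod (map fst (xs @ ys))"
proof (induction xs)
  case (Cons p xs)
  obtain b v where p: "p = (b, v)" by fastforce
  show ?case
    by (simp only: p append_Cons arrow_poly.simps Cons.IH list.map fst_conv monic_prod_simps map_append)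
      (simp only: algebra_simps)
qed simp

lemma degree_lead_coeff_arrow_poly:
  "degree (arrow_poly c ps) = Suc (length ps) \<and> lead_coeff (arrow_poly c ps) = 1"
proof (induction c ps rule: arrow_poly.induct)
  case (2 c a w ps)
  let ?A = "[:- a, 1:] * arrow_poly c ps" and ?B = "[:w:] * monic_prod (map fst ps)"
  have nz: "arrow_poly c ps \<noteq> 0" using 2 by auto
  have dA: "degree ?A = Suc (Suc (length ps))" "lead_coeff ?A = 1"
    using 2 nz degree_mult_eq[of "[:- a, 1:]" "arrow_poly c ps"]
      lead_coeff_mult[of "[:- a, 1:]" "arrow_poly c ps"]
    by (auto simp del: mult_pCons_left)
  have "degree ?B < degree ?A"
    using degree_smult_le[of w "monic_prod (map fst ps)"] dA(1) by simp
  then have "degree (?A - ?B) = degree ?A" "lead_coeff (?A - ?B) = lead_coeff ?A"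
    using degree_add_eq_left[of "- ?B" ?A] lead_coeff_add_le[of "- ?B" ?A]
    by (auto simp: coeff_eq_0)
  then show ?case using dA by simp
qed auto

lemma degree_arrow_poly [simp]: "degree (arrow_poly c ps) = Suc (length ps)"
  and lead_coeff_arrow_poly [simp]: "coeff (arrow_poly c ps) (Suc (length ps)) = 1"
  using degree_lead_coeff_arrow_poly[of c ps] by auto

lemma coeff_arrow_poly_subleading:
  "coeff (arrow_poly c ps) (length ps) = - c - sum_list (map fst ps)"
proof (induction c ps rule: arrow_poly.induct)
  case (2 c a w ps)
  have "coeff (monic_prod (map fst ps)) (Suc (length ps)) = 0"
    by (rule coeff_eq_0) simp
  then show ?case using 2 by (simp add: coeff_pCons)
qed auto

text \<open>The second factor is the secular function of the arrow matrix: the Schur complement of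
  its diagonal part.\<close>

lemma poly_arrow_poly:
  assumes "y \<notin> set (map fst ps)"
  shows "poly (arrow_poly c ps) y
    = poly (monic_prod (map fst ps)) y * (y - c - (\<Sum>(a, w)\<leftarrow>ps. w / (y - a)))"
  using assms
proof (induction c ps rule: arrow_poly.induct)
  case (2 c a w ps)
  let ?P = "poly (monic_prod (map fst ps)) y" and ?S = "\<Sum>(a, w)\<leftarrow>ps. w / (y - a)"
  have IH: "poly (arrow_poly c ps) y = ?P * (y - c - ?S)" using 2 by auto
  have "y - a \<noteq> 0" using 2 by auto
  then have "w * ?P = (y - a) * ?P * (w / (y - a))" by simp
  then have "(y - a) * (?P * (y - c - ?S)) - w * ?P = (y - a) * ?P * (y - c - (w / (y - a) + ?S))"
    by (simp only: right_diff_distrib distrib_left)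
  then show ?case unfolding arrow_poly.simps by (simp add: IH left_diff_distrib mult.assoc)
qed auto

text \<open>A common value of roots and diagonal entries may be cancelled or restored. The new root
  list replaces the root \<open>b\<close> at the insertion position by \<open>min b a\<close> and
  \<open>max b a\<close>, which enclose \<open>a\<close>.\<close>

lemma interlaced_insert:
  assumes "interlaced bs (xs @ ys)" "sorted (xs @ a # ys)"
  shows "\<exists>bs'. interlaced bs' (xs @ a # ys) \<and> mset bs' = add_mset a (mset bs)"
proof -
  let ?m = "length xs"
  let ?b = "bs ! ?m"
  have len: "length bs = Suc (?m + length ys)" using assms(1) by (auto simp: interlaced_def)
  let ?bs = "take ?m bs @ min ?b a # max ?b a # drop (Suc ?m) bs"
  have bs: "bs = take ?m bs @ ?b # drop (Suc ?m) bs"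
    using len by (simp add: id_take_nth_drop)
  have "mset ?bs = add_mset a (add_mset ?b (mset (take ?m bs) + mset (drop (Suc ?m) bs)))"
    by (simp add: min_def max_def)
  also have "\<dots> = add_mset a (mset bs)" by (subst (4) bs) simp
  finally have m: "mset ?bs = add_mset a (mset bs)" .
  have I: "bs ! i \<le> (xs @ ys) ! i" "(xs @ ys) ! i \<le> bs ! Suc i" if "i < ?m + length ys" for i
    using assms(1) that by (auto simp: interlaced_def)
  have so: "x \<le> a" if "x \<in> set xs" for x using that assms(2) by (auto simp: sorted_append)
  have so2: "a \<le> x" if "x \<in> set ys" for x using that assms(2) by (auto simp: sorted_append)
  have "interlaced ?bs (xs @ a # ys)"
    unfolding interlaced_def
  proof (intro conjI allI impI)
    show "length ?bs = Suc (length (xs @ a # ys))" using len by simp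
    fix i assume i: "i < length (xs @ a # ys)"
    consider "i < ?m" "Suc i < ?m" | "i < ?m" "Suc i = ?m" | "i = ?m" | "i = Suc ?m" | "i > Suc ?m" by linarith
    then have "?bs ! i \<le> (xs @ a # ys) ! i \<and> (xs @ a # ys) ! i \<le> ?bs ! Suc i"
    proof cases
      case 1 then show ?thesis using I[of i] len by (auto simp: nth_append)
    next
      case 2 then show ?thesis using I[of i] len so[of "xs ! i"] by (auto simp: nth_append)
    next
      case 3 then show ?thesis using len by (auto simp: nth_append)
    next
      case 4
      then have "ys \<noteq> []" using i by auto
      then show ?thesis using I[of ?m] so2[of "ys ! 0"] 4 len
        by (auto simp: nth_append)
    next
      case 5
      then obtain j where j: "i = Suc (Suc (?m + j))" using less_imp_Suc_add[of "Suc ?m" i] by auto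
      show ?thesis using I[of "Suc (?m + j)"] len j i by (auto simp: nth_append)
    qed
    then show "?bs ! i \<le> (xs @ a # ys) ! i" "(xs @ a # ys) ! i \<le> ?bs ! Suc i" by auto
  qed
  with m show ?thesis by blast
qed

lemma monic_prod_mset_cong: "mset xs = mset ys \<Longrightarrow> monic_prod xs = monic_prod ys"
  unfolding monic_prod_def by (metis mset_map prod_mset_prod_list)

text \<open>At each diagonal entry only the term with its positive weight survives, so the signs
  alternate along the entries. Together with the signs near both infinities this gives one root in
  each of \<open>length ps + 1\<close> gaps; these are all roots, since the polynomial is monic of
  that degree.\<close>

lemma arrow_poly_interlaced_strict:
  assumes "sorted_wrt (<) (map fst ps)" "\<And>a w. (a, w) \<in> set ps \<Longrightarrow> 0 < w"
  shows "\<exists>bs. interlaced bs (map fst ps) \<and> arrow_poly c ps = monic_prod bs"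
proof (cases "ps = []")
  case True
  then show ?thesis by (intro exI[of _ "[c]"]) (auto simp: interlaced_def)
next
  case False
  let ?N = "length ps" and ?G = "arrow_poly c ps"
  define a where "a i = fst (ps ! i)" for i
  have a_less: "a i < a j" if "i < j" "j < ?N" for i j
    using assms(1) that by (auto simp: sorted_wrt_iff_nth_less a_def)
  have sgn_a: "0 < (-1) ^ (?N - i) * poly ?G (a i)" if i: "i < ?N" for i
  proof -
    let ?xs = "take i ps" and ?ys = "drop (Suc i) ps"
    obtain w where w: "ps ! i = (a i, w)" unfolding a_def by (metis prod.collapse)
    have ps: "ps = ?xs @ (a i, w) # ?ys"
      using i w by (metis id_take_nth_drop)
    have "0 < w" using assms(2)[of "a i" w] i w nth_mem by metis
    moreover have "0 < (-1) ^ length (map fst ?ys) * poly (monic_prod (map fst ?xs @ map fst ?ys)) (a i)"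
    proof (rule poly_monic_prod_sign)
      fix x assume "x \<in> set (map fst ?xs)"
      then obtain j where "j < i" "x = a j"
        using i by (auto simp: in_set_conv_nth a_def)
      then show "x < a i" using a_less i by auto
    next
      fix x assume "x \<in> set (map fst ?ys)"
      then obtain j where "j < ?N - Suc i" "x = a (Suc i + j)"
        using i by (auto simp: in_set_conv_nth a_def)
      then show "a i < x" using a_less by auto
    qed
    moreover have "poly ?G (a i) = - w * poly (monic_prod (map fst ?xs @ map fst ?ys)) (a i)"
      by (subst ps, subst arrow_poly_remove) simp
    moreover have "?N - i = Suc (length (map fst ?ys))" using i by simp
    ultimately show ?thesis
      by (simp add: zero_less_mult_iff mult_less_0_iff)
  qed
  obtain U where U: "a (?N - 1) < U" "0 < poly ?G U"
  proof -
    obtain n where n: "\<forall>x\<ge>n. poly ?G x \<ge> lead_coeff ?G"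
      using poly_pinfty_gt_lc[of ?G] by auto
    show ?thesis
      using that[of "max n (a (?N - 1) + 1)"] n[rule_format, of "max n (a (?N - 1) + 1)"] by auto
  qed
  obtain L where L: "L < a 0" "0 < (-1) ^ Suc ?N * poly ?G L"
  proof -
    \<comment> \<open>Reflecting the argument moves the behaviour at minus infinity to plus
      infinity; the sign factor makes the reflected polynomial monic.\<close>
    define H where "H = Polynomial.smult ((-1) ^ Suc ?N) (pcompose ?G [:0, -1:])"
    have "lead_coeff H = 1"
      using lead_coeff_comp[of "[:0, -1 :: real:]" ?G]
      by (simp add: H_def power_mult_distrib[symmetric] flip: power_Suc)
    then obtain n where n: "\<forall>x\<ge>n. poly H x \<ge> 1"
      using poly_pinfty_gt_lc[of H] by auto
    show ?thesis
      using that[of "- max n (1 - a 0)"] n[rule_format, of "max n (1 - a 0)"]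
      by (auto simp: H_def poly_pcompose)
  qed
  \<comment> \<open>The test points are \<open>L\<close>, all diagonal entries and \<open>U\<close>,
    so the entry \<open>a i\<close> has index \<open>i + 1\<close> here.\<close>
  define e where "e j = (if j = 0 then L else if j = Suc ?N then U else a (j - 1))" for j
  have e_less: "e j < e (Suc j)" if "j \<le> ?N" for j
    using that L U a_less[of "j - 1" j] False by (auto simp: e_def)
  have sgn_e: "0 < (-1) ^ (Suc ?N - j) * poly ?G (e j)" if "j \<le> Suc ?N" for j
    using that L U sgn_a[of "j - 1"] by (auto simp: e_def Suc_diff_le)
  have "\<exists>x. e j < x \<and> x < e (Suc j) \<and> poly ?G x = 0" if j: "j \<le> ?N" for j
  proof -
    have "0 < (-1) ^ (?N - j) * (-1) ^ Suc (?N - j) * (poly ?G (e j) * poly ?G (e (Suc j)))"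
      using mult_pos_pos[OF sgn_e[of j] sgn_e[of "Suc j"]] j by (simp add: Suc_diff_le ac_simps)
    then have "poly ?G (e j) * poly ?G (e (Suc j)) < 0"
      by (simp flip: power_mult_distrib)
    then show ?thesis using poly_IVT[OF e_less[OF j], of ?G] by blast
  qed
  then obtain b where b: "\<And>j. j \<le> ?N \<Longrightarrow> e j < b j \<and> b j < e (Suc j) \<and> poly ?G (b j) = 0"
    by metis
  define bs where "bs = map b [0..<Suc ?N]"
  have len: "length bs = Suc ?N" by (simp add: bs_def)
  have "interlaced bs (map fst ps)"
    unfolding interlaced_def
  proof (intro conjI allI impI)
    show "length bs = Suc (length (map fst ps))" using len by simp
    fix i assume "i < length (map fst ps)"
    then show "bs ! i \<le> map fst ps ! i" "map fst ps ! i \<le> bs ! Suc i"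
      using b[of i] b[of "Suc i"]
      by (auto simp: bs_def e_def a_def less_imp_le simp del: upt_Suc)
  qed
  moreover have "?G = monic_prod bs"
  proof -
    have bmono: "b i < b j" if "i < j" "j \<le> ?N" for i j
      using that
    proof (induction j)
      case (Suc j)
      have "b j < b (Suc j)" using b[of j] b[of "Suc j"] Suc by force
      then show ?case using Suc by (cases "i = j") auto
    qed auto
    have inj: "inj_on b {0..<Suc ?N}"
      by (rule inj_onI) (metis atLeastLessThan_iff bmono less_Suc_eq_le linorder_neqE_nat order_less_irrefl)
    let ?S = "b ` {0..<Suc ?N}"
    have c: "card ?S = Suc ?N" using inj by (simp add: card_image)
    show ?thesis
    proof (rule poly_eqI_degree_lead_coeff[where A = ?S and n = "Suc ?N"])
      show "poly ?G x = poly (monic_prod bs) x" if x: "x \<in> ?S" for x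
      proof -
        obtain j where "j \<in> {0..<Suc ?N}" "x = b j" using x by blast
        moreover have "x \<in> set bs" using x by (simp add: bs_def del: upt_Suc)
        ultimately show ?thesis using b[of j] poly_monic_prod_at_root[of x bs] by simp
      qed
      show "card ?S \<ge> Suc ?N" using c by simp
      show "degree ?G \<le> Suc ?N" "degree (monic_prod bs) \<le> Suc ?N"
        using len by simp_all
      show "coeff ?G (Suc ?N) = coeff (monic_prod bs) (Suc ?N)"
        using lead_coeff_monic_prod[of bs] len by simp
    qed
  qed
  ultimately show ?thesis by blast
qed

text \<open>The degenerate cases are deflated until the strict one remains: an entry of weight 0
  splits off as a linear factor, and two entries with equal diagonal value act as one entry with the
  summed weight, again leaving a linear factor. \<open>cancel\<close> is the step common to
  both.\<close>

lemma arrow_poly_interlaced: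
  assumes "sorted (map fst ps)" "\<And>a w. (a, w) \<in> set ps \<Longrightarrow> 0 \<le> w"
  shows "\<exists>bs. interlaced bs (map fst ps) \<and> arrow_poly c ps = monic_prod bs"
  using assms
proof (induction "length ps" arbitrary: ps rule: less_induct)
  case less
  have cancel: ?case
    if qs: "length qs < length ps" "sorted (map fst qs)" "\<And>a w. (a, w) \<in> set qs \<Longrightarrow> 0 \<le> w"
      and G: "arrow_poly c ps = [:- a, 1:] * arrow_poly c qs"
      and f: "map fst ps = xs @ a # ys" "map fst qs = xs @ ys" for qs a xs ys
  proof -
    obtain bs where bs: "interlaced bs (xs @ ys)" "arrow_poly c qs = monic_prod bs"
      using less.hyps[OF qs(1,2)] qs(3) f(2) by metis
    obtain bs' where bs': "interlaced bs' (xs @ a # ys)" "mset bs' = add_mset a (mset bs)"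
      using interlaced_insert[OF bs(1)] less.prems(1) f(1) by auto
    have "arrow_poly c ps = monic_prod (a # bs)" using G bs(2) by simp
    also have "\<dots> = monic_prod bs'" using bs'(2) by (intro monic_prod_mset_cong) simp
    finally show ?thesis using bs'(1) f(1) by auto
  qed
  show ?case
  proof (cases "\<exists>a. (a, 0) \<in> set ps")
    case True
    then obtain a xs ys where ps: "ps = xs @ (a, 0) # ys" by (meson split_list)
    show ?thesis
    proof (rule cancel[where qs = "xs @ ys"])
      show "arrow_poly c ps = [:- a, 1:] * arrow_poly c (xs @ ys)"
        unfolding ps arrow_poly_remove by simp
      show "0 \<le> w" if "(a', w) \<in> set (xs @ ys)" for a' w
        using less.prems(2)[of a' w] that ps by auto
    qed (use less.prems(1) in \<open>auto simp: ps sorted_append\<close>)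
  next
    case no0: False
    show ?thesis
    proof (cases "distinct (map fst ps)")
      case True
      have "sorted_wrt (<) (map fst ps)"
        using True less.prems(1) by (simp add: strict_sorted_iff)
      moreover have "0 < w" if "(a, w) \<in> set ps" for a w
        using less.prems(2)[OF that] no0 that by (cases "w = 0") auto
      ultimately show ?thesis by (rule arrow_poly_interlaced_strict)
    next
      case False
      then obtain as a bs cs where "map fst ps = as @ [a] @ bs @ [a] @ cs"
        using not_distinct_decomp by blast
      then obtain xs p ys q zs where
        "ps = xs @ p # ys @ q # zs" "fst p = a" "fst q = a"
        by (auto simp: map_eq_append_conv map_eq_Cons_conv Cons_eq_map_conv append_eq_map_conv)
      then obtain w v where ps: "ps = xs @ (a, w) # ys @ (a, v) # zs"
        by (metis prod.collapse)
      have wv: "0 \<le> w" "0 \<le> v" using less.prems(2) by (auto simp: ps)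
      show ?thesis
      proof (rule cancel[where qs = "xs @ (a, w + v) # ys @ zs"])
        have 1: "arrow_poly c (xs @ (a, w) # ys @ (a, v) # zs)
          = [:- a, 1:] * arrow_poly c (xs @ (a, w) # ys @ zs)
            - [:v:] * monic_prod (map fst (xs @ (a, w) # ys @ zs))"
          using arrow_poly_remove[of c "xs @ (a, w) # ys" a v zs] by simp
        show "arrow_poly c ps = [:- a, 1:] * arrow_poly c (xs @ (a, w + v) # ys @ zs)"
        proof -
          have "[:w + v:] = [:w:] + [:v:]" by simp
          then show ?thesis
            unfolding ps 1 arrow_poly_remove[of c xs a _ "ys @ zs"]
            by (simp only: map_append list.map fst_conv monic_prod_simps) (simp only: algebra_simps)
        qed
        show "map fst ps = (map fst xs @ [a] @ map fst ys) @ a # map fst zs" by (simp add: ps)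
        show "0 \<le> w'" if "(a', w') \<in> set (xs @ (a, w + v) # ys @ zs)" for a' w'
          using less.prems(2)[of a' w'] that wv by (auto simp: ps)
      qed (use less.prems(1) in \<open>auto simp: ps sorted_append\<close>)
    qed
  qed
qed

lemma arrow_poly_roots_sum:
  assumes "arrow_poly c ps = monic_prod bs"
  shows "sum_list bs = c + sum_list (map fst ps)"
proof -
  have "length bs = Suc (length ps)"
    using arg_cong[OF assms, of degree] by simp
  then show ?thesis
    using coeff_arrow_poly_subleading[of c ps] coeff_monic_prod_subleading[of bs] assms
    by (cases bs) auto
qed

section \<open>Laplacians of trees given by a parent function\<close>

text \<open>\<open>M = V U\<^sup>T\<close> with \<open>V\<close> upper triangular and \<open>U\<close> upper unitriangular: eliminating the vertices of a tree
  from the leaves to the root produces no fill-in.\<close>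

lemma det_parent_mat:
  fixes a :: "nat \<Rightarrow> 'a :: field"
  assumes M: "M \<in> carrier_mat n n"
    and par: "\<And>j. 0 < j \<Longrightarrow> j < n \<Longrightarrow> par j < j"
    and nz: "\<And>j. 0 < j \<Longrightarrow> j < n \<Longrightarrow> a j \<noteq> 0"
    and diag: "\<And>i. i < n \<Longrightarrow> M $$ (i, i) = a i + (\<Sum>l | 0 < l \<and> l < n \<and> par l = i. 1 / a l)"
    and off: "\<And>i j. i < n \<Longrightarrow> j < n \<Longrightarrow> i \<noteq> j \<Longrightarrow>
      M $$ (i, j) = (if 0 < j \<and> par j = i \<or> 0 < i \<and> par i = j then 1 else 0)"
  shows "det M = (\<Prod>i<n. a i)"
proof -
  define V where "V = mat n n (\<lambda>(i, l). if i = l then a l else if 0 < l \<and> par l = i then 1 else 0)"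
  define U where "U = mat n n (\<lambda>(i, l). if i = l then 1 else if 0 < l \<and> par l = i then 1 / a l else 0)"
  have V: "V \<in> carrier_mat n n" and U: "U \<in> carrier_mat n n" by (auto simp: V_def U_def)
  have "par l \<noteq> i" if "0 < l" "l < i" "i < n" for l i
    using par[of l] that by auto
  then have "upper_triangular V" "upper_triangular U"
    by (auto simp: V_def U_def upper_triangular_def)
  moreover have "diag_mat V = map a [0..<n]" "diag_mat U = map (\<lambda>_. 1) [0..<n]"
    using V U by (auto simp: diag_mat_def V_def U_def intro!: nth_equalityI)
  ultimately have "det V = prod_list (map a [0..<n])" "det U = prod_list (map (\<lambda>_. 1) [0..<n])"
    using det_upper_triangular[OF _ V] det_upper_triangular[OF _ U] by simp_all
  then have dV: "det V = (\<Prod>i<n. a i)" and dU: "det U = 1"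
    by (simp_all add: atLeast0LessThan map_replicate_const flip: prod.distinct_set_conv_list)
  have "M = V * transpose_mat U"
  proof (rule eq_matI)
    fix i j assume "i < dim_row (V * transpose_mat U)" "j < dim_col (V * transpose_mat U)"
    then have ij: "i < n" "j < n" using U V by auto
    have "(V * transpose_mat U) $$ (i, j) = (\<Sum>l<n. V $$ (i, l) * U $$ (j, l))"
      using ij U V by (simp add: scalar_prod_def atLeast0LessThan)
    also have "\<dots> = M $$ (i, j)"
    proof (cases "i = j")
      case True
      have "(\<Sum>l<n. V $$ (i, l) * U $$ (j, l))
          = (\<Sum>l<n. (if l = i then a i else 0) + (if 0 < l \<and> par l = i then 1 / a l else 0))"
        using ij True par[of i] by (intro sum.cong) (auto simp: V_def U_def)
      also have "\<dots> = a i + (\<Sum>l | 0 < l \<and> l < n \<and> par l = i. 1 / a l)"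
        using ij by (simp add: sum.distrib sum.If_cases lessThan_def Int_def conj_ac)
      finally show ?thesis using diag[OF ij(1)] True by simp
    next
      case False
      \<comment> \<open>Any \<open>l\<close> other than \<open>i\<close> and \<open>j\<close> would
        need both of them as its parent, so only these two indices contribute.\<close>
      have "(\<Sum>l<n. V $$ (i, l) * U $$ (j, l))
          = (\<Sum>l<n. (if l = i then if 0 < i \<and> par i = j then 1 else 0 else 0)
              + (if l = j then if 0 < j \<and> par j = i then 1 else 0 else 0))"
        using ij False nz by (intro sum.cong) (auto simp: V_def U_def)
      also have "\<dots> = (if 0 < i \<and> par i = j then 1 else 0) + (if 0 < j \<and> par j = i then 1 else 0)"
        using ij by (simp add: sum.distrib)
      also have "\<dots> = M $$ (i, j)"
        using off[OF ij False] par[of i] par[of j] ij by auto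
      finally show ?thesis .
    qed
    finally show "M $$ (i, j) = (V * transpose_mat U) $$ (i, j)" by simp
  qed (use M U V in auto)
  then have "det M = det V * det (transpose_mat U)"
    using det_mult[OF V, of "transpose_mat U"] U by simp
  then show ?thesis using dV dU det_transpose[OF U] by simp
qed

text \<open>The root is \<open>vs ! 0\<close>, and \<open>par j\<close> is the index of the parent of \<open>vs ! j\<close>; the value \<open>par 0\<close> is
  irrelevant.\<close>

definition parent_enum :: "'a pair_pre_digraph \<Rightarrow> 'a list \<Rightarrow> (nat \<Rightarrow> nat) \<Rightarrow> bool" where
  "parent_enum G vs par \<longleftrightarrow> distinct vs \<and> set vs = pverts G \<and> parcs G \<subseteq> pverts G \<times> pverts G \<and>
     (\<forall>j. 0 < j \<and> j < length vs \<longrightarrow> par j < j) \<and>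
     (\<forall>i<length vs. \<forall>j<length vs.
        (vs ! i, vs ! j) \<in> parcs G \<longleftrightarrow> 0 < j \<and> par j = i \<or> 0 < i \<and> par i = j)"

context
  fixes G :: "'a pair_pre_digraph" and vs :: "'a list" and par :: "nat \<Rightarrow> nat"
  assumes pe: "parent_enum G vs par"
begin

lemma parent_enumD:
  shows "distinct vs" "set vs = pverts G"
    and "(u, v) \<in> parcs G \<Longrightarrow> u \<in> pverts G" "(u, v) \<in> parcs G \<Longrightarrow> v \<in> pverts G"
    and "0 < j \<Longrightarrow> j < length vs \<Longrightarrow> par j < j"
    and "i < length vs \<Longrightarrow> j < length vs \<Longrightarrow>
      (vs ! i, vs ! j) \<in> parcs G \<longleftrightarrow> 0 < j \<and> par j = i \<or> 0 < i \<and> par i = j"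
proof -
  note pe' = pe[unfolded parent_enum_def]
  show "distinct vs" "set vs = pverts G" using pe' by simp_all
  have "parcs G \<subseteq> pverts G \<times> pverts G" using pe' by simp
  then show "u \<in> pverts G" "v \<in> pverts G" if "(u, v) \<in> parcs G" using that by auto
  show "par j < j" if "0 < j" "j < length vs" using pe' that by simp
  show "(vs ! i, vs ! j) \<in> parcs G \<longleftrightarrow> 0 < j \<and> par j = i \<or> 0 < i \<and> par i = j"
    if "i < length vs" "j < length vs" using pe' that by simp
qed

text \<open>Every edge joins exactly one non-root index to its parent. Two indices giving the same
  edge would otherwise be each other's parents, against \<open>par j < j\<close>.\<close>

lemma parent_enum_card_edges: "card (edges G) = length vs - 1"
proof -
  let ?e = "\<lambda>j. {vs ! par j, vs ! j}"
  have nth: "vs ! i = vs ! j \<longleftrightarrow> i = j" if "i < length vs" "j < length vs" for i j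
    using that parent_enumD(1) by (simp add: nth_eq_iff_index_eq)
  have img: "edges G = ?e ` {0<..<length vs}"
  proof (intro equalityI subsetI)
    fix e assume "e \<in> edges G"
    then obtain u v where uv: "e = {u, v}" "(u, v) \<in> parcs G" by (auto simp: edges_def)
    then have "u \<in> set vs" "v \<in> set vs" using parent_enumD(2) parent_enumD(3,4)[of u v] by simp_all
    then obtain i j where ij: "u = vs ! i" "i < length vs" "v = vs ! j" "j < length vs"
      by (auto simp: in_set_conv_nth)
    then have "0 < j \<and> par j = i \<or> 0 < i \<and> par i = j" using uv parent_enumD(6)[of i j] by simp
    then consider "0 < j" "par j = i" | "0 < i" "par i = j" by metis
    then show "e \<in> ?e ` {0<..<length vs}"
    proof cases
      case 1 then show ?thesis using ij uv by (intro image_eqI[of _ _ j]) auto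
    next
      case 2 then show ?thesis using ij uv by (intro image_eqI[of _ _ i]) auto
    qed
  next
    fix e assume "e \<in> ?e ` {0<..<length vs}"
    then obtain j where j: "e = ?e j" "0 < j" "j < length vs" by auto
    then have "(vs ! par j, vs ! j) \<in> parcs G"
      using parent_enumD(5)[of j] parent_enumD(6)[of "par j" j] by auto
    then show "e \<in> edges G" using j by (auto simp: edges_def)
  qed
  have "inj_on ?e {0<..<length vs}"
  proof (rule inj_onI)
    fix i j assume ij: "i \<in> {0<..<length vs}" "j \<in> {0<..<length vs}" "?e i = ?e j"
    then have lt: "par i < i" "par j < j" using parent_enumD(5) by auto
    show "i = j"
    proof (rule ccontr)
      assume "i \<noteq> j"
      then have "vs ! i \<noteq> vs ! j" using nth ij by simp
      then have "vs ! i = vs ! par j" "vs ! par i = vs ! j"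
        using ij(3) by (metis doubleton_eq_iff)+
      then have "i = par j" "par i = j" using nth[of i "par j"] nth[of "par i" j] ij(1,2) lt by simp_all
      then show False using lt by linarith
    qed
  qed
  then have "card (edges G) = card {0<..<length vs}" unfolding img by (rule card_image)
  then show ?thesis by simp
qed

lemma parent_enum_out_degree:
  assumes "i < length vs"
  shows "out_degree (with_proj G) (vs ! i)
    = (if 0 < i then 1 else 0) + card {j. 0 < j \<and> j < length vs \<and> par j = i}"
proof -
  let ?C = "{j. 0 < j \<and> j < length vs \<and> par j = i}"
  let ?N = "?C \<union> (if 0 < i then {par i} else {})"
  have fin: "finite ?C" by simp
  have "out_arcs (with_proj G) (vs ! i) = (\<lambda>j. (vs ! i, vs ! j)) ` ?N"
  proof (intro equalityI subsetI)
    fix e assume "e \<in> out_arcs (with_proj G) (vs ! i)"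
    then have e: "e \<in> parcs G" "fst e = vs ! i" by auto
    then obtain v where v: "e = (vs ! i, v)" by (metis prod.collapse)
    then have "v \<in> set vs" using e parent_enumD(2) parent_enumD(4)[of "vs ! i" v] by simp
    then obtain j where j: "v = vs ! j" "j < length vs" by (auto simp: in_set_conv_nth)
    then have "j \<in> ?N" using e v parent_enumD(6)[of i j] assms by auto
    then show "e \<in> (\<lambda>j. (vs ! i, vs ! j)) ` ?N" using v j by blast
  next
    fix e assume "e \<in> (\<lambda>j. (vs ! i, vs ! j)) ` ?N"
    then show "e \<in> out_arcs (with_proj G) (vs ! i)"
      using parent_enumD(6)[of i] assms parent_enumD(5)[of i] by (auto split: if_splits)
  qed
  moreover have "inj_on (\<lambda>j. (vs ! i, vs ! j)) ?N"
    using parent_enumD(1) parent_enumD(5)[of i] assms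
    by (auto simp: inj_on_def nth_eq_iff_index_eq)
  moreover have "par i \<notin> ?C" if "0 < i" using parent_enumD(5)[of i] parent_enumD(5)[of "par i"] that assms by auto
  ultimately show ?thesis unfolding out_degree_def using fin by (auto simp: card_image)
qed

text \<open>The \<open>a i\<close> are the pivots of \<open>x * I - L\<close> under elimination from
  the leaves to the root. The adjacency matrix enters \<open>L\<close> with a minus sign, so the
  entries at edges are +1 as \<open>det_parent_mat\<close> requires.\<close>

lemma parent_enum_poly_char_poly:
  assumes a: "\<And>i. i < length vs \<Longrightarrow>
      a i = x - real (out_degree (with_proj G) (vs ! i)) - (\<Sum>l | 0 < l \<and> l < length vs \<and> par l = i. 1 / a l)"
    and nz: "\<And>i. 0 < i \<Longrightarrow> i < length vs \<Longrightarrow> a i \<noteq> 0"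
  shows "poly (char_poly (laplacian_mat G vs)) x = (\<Prod>i<length vs. a i)"
proof -
  let ?n = "length vs" and ?L = "laplacian_mat G vs"
  have L: "?L \<in> carrier_mat ?n ?n"
    by (auto simp: laplacian_mat_def degree_mat_def adjacency_mat_def intro!: minus_carrier_mat)
  have "poly (char_poly ?L) x = det (- char_matrix ?L x)"
    by (rule char_poly_matrix[OF L])
  also have "\<dots> = (\<Prod>i<?n. a i)"
  proof (rule det_parent_mat[where par = par])
    show "- char_matrix ?L x \<in> carrier_mat ?n ?n" using L by simp
  next
    fix i assume i: "i < ?n"
    have "(vs ! i, vs ! i) \<notin> parcs G" using parent_enumD(5,6)[of i] i by auto
    then show "(- char_matrix ?L x) $$ (i, i)
        = a i + (\<Sum>l | 0 < l \<and> l < ?n \<and> par l = i. 1 / a l)"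
      using i L a[OF i] by (simp add: char_matrix_def laplacian_mat_def degree_mat_def adjacency_mat_def)
  next
    fix i j assume "i < ?n" "j < ?n" "i \<noteq> j"
    then show "(- char_matrix ?L x) $$ (i, j)
        = (if 0 < j \<and> par j = i \<or> 0 < i \<and> par i = j then 1 else 0)"
      using L parent_enumD(6)[of i j]
      by (simp add: char_matrix_def laplacian_mat_def degree_mat_def adjacency_mat_def)
  qed (use parent_enumD(5) nz in auto)
  finally show ?thesis .
qed

lemma parent_enum_laplacian_energy:
  assumes "vs \<noteq> []"
  shows "laplacian_energy G
    = (\<Sum>\<mu>\<in>#proots (char_poly (laplacian_mat G vs)). \<bar>\<mu> - (2 - 2 / length vs)\<bar>)"
proof -
  have "card (pverts G) = length vs" using parent_enumD(1,2) by (metis distinct_card)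
  then have "average_degree G = 2 - 2 / length vs"
    using assms by (simp add: average_degree_def parent_enum_card_edges of_nat_diff Suc_le_eq field_simps)
  then show ?thesis
    unfolding laplacian_energy_def using laplacian_spectrum_eq parent_enumD(1,2) by metis
qed

end

text \<open>The pivots can be used only away from finitely many points; identities obtained there
  extend to the polynomials.\<close>

lemma poly_eqI_cofinite:
  fixes p q :: "'a :: {idom, ring_char_0} poly"
  assumes "finite S" "\<And>x. x \<notin> S \<Longrightarrow> poly p x = poly q x"
  shows "p = q"
proof (rule ccontr)
  assume "p \<noteq> q"
  then have "finite {x. poly (p - q) x = 0}" by (intro poly_roots_finite) auto
  then have "finite (S \<union> {x. poly (p - q) x = 0})" using assms(1) by blast
  moreover have "S \<union> {x. poly (p - q) x = 0} = UNIV" using assms(2) by auto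
  ultimately show False using infinite_UNIV_char_0 by metis
qed

lemma parent_enum_path_graph: "parent_enum (path_graph n) [0..<n] (\<lambda>j. j - 1)"
  by (auto simp: parent_enum_def path_graph_def)

lemma parent_enum_star_graph: "parent_enum (star_graph n) [0..<n] (\<lambda>_. 0)"
  by (auto simp: parent_enum_def star_graph_def)

section \<open>The spectrum of a tree of diameter 4\<close>

definition theta :: "nat \<Rightarrow> real" where
  "theta p = (real p + 2 + sqrt (real p ^ 2 + 4 * real p)) / 2"

definition alpha :: "nat \<Rightarrow> real" where
  "alpha p = (real p + 2 - sqrt (real p ^ 2 + 4 * real p)) / 2"

lemma alpha_theta: "alpha p + theta p = p + 2" "alpha p * theta p = 1"
proof -
  show "alpha p + theta p = p + 2" by (simp add: alpha_def theta_def field_simps)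
  have "sqrt (real p ^ 2 + 4 * p) * sqrt (real p ^ 2 + 4 * p) = real p ^ 2 + 4 * p"
    by (rule real_sqrt_mult_self[THEN trans]) simp
  then show "alpha p * theta p = 1"
    by (simp add: alpha_def theta_def algebra_simps power2_eq_square)
qed

lemma alpha_theta_quadratic: "(x - alpha p) * (x - theta p) = x\<^sup>2 - (real p + 2) * x + 1"
proof -
  have "(x - alpha p) * (x - theta p) = x\<^sup>2 - (alpha p + theta p) * x + alpha p * theta p"
    by (simp add: algebra_simps power2_eq_square)
  then show ?thesis unfolding alpha_theta by simp
qed

lemma theta_ge: "theta p \<ge> p + 1" "theta p \<ge> 1" "theta p > 0" "0 < p \<Longrightarrow> theta p > p + 1"
proof -
  have "sqrt (real p ^ 2) \<le> sqrt (real p ^ 2 + 4 * p)" by (intro real_sqrt_le_mono) simp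
  then show "theta p \<ge> p + 1" by (simp add: theta_def)
  then show "theta p \<ge> 1" "theta p > 0" by simp_all
  assume "0 < p"
  then have "sqrt (real p ^ 2) < sqrt (real p ^ 2 + 4 * p)" by (intro real_sqrt_less_mono) simp
  then show "theta p > p + 1" by (simp add: theta_def)
qed

lemma theta_mono: "p \<le> q \<Longrightarrow> theta p \<le> theta q"
  unfolding theta_def by (intro divide_right_mono add_mono real_sqrt_le_mono power_mono) auto

lemma alpha_eq: "alpha p = 1 / theta p"
  using alpha_theta(2)[of p] theta_ge(3)[of p] by (simp add: field_simps)

lemma alpha_pos: "0 < alpha p" and alpha_le_1: "alpha p \<le> 1"
  using theta_ge(2,3)[of p] by (simp_all add: alpha_eq)

lemma alpha_antimono: "p \<le> q \<Longrightarrow> alpha q \<le> alpha p"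
  using theta_mono[of p q] theta_ge(3)[of p] by (simp add: alpha_eq frac_le)

lemma theta_le: "theta p \<le> p + 2"
  using alpha_theta(1)[of p] alpha_pos[of p] by simp

lemma alpha_ge: "1 / (p + 2) \<le> alpha p"
  using theta_le[of p] theta_ge(3)[of p] by (simp add: alpha_eq frac_le)

lemma alpha_0 [simp]: "alpha 0 = 1" and theta_0 [simp]: "theta 0 = 1"
  by (simp_all add: alpha_def theta_def)

text \<open>If \<open>p j = 0\<close>, then \<open>alpha (p j) = theta (p j) = 1\<close>: a leaf attached to the centre counts as a
  double pole at \<open>1\<close>, which makes the number of poles \<open>2 * k\<close> in all cases.\<close>

definition branch_poles :: "(nat \<Rightarrow> nat) \<Rightarrow> nat \<Rightarrow> real list" where
  "branch_poles p k = map (\<lambda>j. alpha (p j)) [0..<k] @ rev (map (\<lambda>j. theta (p j)) [0..<k])"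

text \<open>The pivot of the centre of the tree: \<open>x - k\<close> is its diagonal entry in
  \<open>x * I - L\<close>, and branch \<open>j\<close> subtracts the reciprocal of its own
  pivot.\<close>

definition secular :: "(nat \<Rightarrow> nat) \<Rightarrow> nat \<Rightarrow> real \<Rightarrow> real" where
  "secular p k x = x - k - (\<Sum>j<k. (x - 1) / (x\<^sup>2 - (real (p j) + 2) * x + 1))"

lemma length_branch_poles [simp]: "length (branch_poles p k) = 2 * k"
  by (simp add: branch_poles_def)

lemma branch_poles_nth:
  assumes "i < 2 * k"
  shows "branch_poles p k ! i = (if i < k then alpha (p i) else theta (p (2 * k - 1 - i)))"
proof (cases "i < k")
  case False
  then have "k - Suc (i - k) = 2 * k - 1 - i" "2 * k - 1 - i < k" using assms by simp_all
  then show ?thesis using False assms by (simp add: branch_poles_def nth_append rev_nth)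
qed (simp add: branch_poles_def nth_append)

lemma sorted_branch_poles:
  assumes "\<And>i j. i \<le> j \<Longrightarrow> j < k \<Longrightarrow> p j \<le> p i"
  shows "sorted (branch_poles p k)"
proof -
  have "branch_poles p k ! i \<le> branch_poles p k ! j" if "i \<le> j" "j < 2 * k" for i j
  proof -
    consider "j < k" | "i < k" "k \<le> j" | "k \<le> i" by linarith
    then show ?thesis
    proof cases
      case 1
      then show ?thesis using that alpha_antimono[OF assms[of i j]] by (simp add: branch_poles_nth)
    next
      case 2
      then show ?thesis using that alpha_le_1[of "p i"] theta_ge(2)[of "p (2 * k - 1 - j)"]
        by (simp add: branch_poles_nth)
    next
      case 3
      have "p (2 * k - 1 - i) \<le> p (2 * k - 1 - j)" by (rule assms) (use 3 that in auto)
      then show ?thesis using 3 that theta_mono by (simp add: branch_poles_nth)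
    qed
  qed
  then show ?thesis by (simp add: sorted_iff_nth_mono)
qed

text \<open>The residues are positive, so they can serve as squared off-diagonal entries of an arrow
  matrix. The numerators combine because \<open>alpha p * theta p = 1\<close>; for
  \<open>p = 0\<close> both poles are 1 and each gets weight 1/2.\<close>

lemma branch_partial_fractions:
  assumes "x \<noteq> alpha p" "x \<noteq> theta p"
  shows "1 / (theta p + 1) / (x - alpha p) + theta p / (theta p + 1) / (x - theta p)
    = (x - 1) / (x\<^sup>2 - (real p + 2) * x + 1)"
proof -
  let ?a = "alpha p" and ?t = "theta p"
  have t: "?t + 1 \<noteq> 0" using theta_ge(3)[of p] by linarith
  have nz: "x - ?a \<noteq> 0" "x - ?t \<noteq> 0" using assms by auto
  have "1 / (?t + 1) / (x - ?a) + ?t / (?t + 1) / (x - ?t)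
      = ((x - ?t) + ?t * (x - ?a)) / ((?t + 1) * ((x - ?a) * (x - ?t)))"
    using t nz by (simp add: divide_simps)
  also have "(x - ?t) + ?t * (x - ?a) = (?t + 1) * (x - 1)"
    using alpha_theta(2)[of p] by (simp add: algebra_simps)
  finally show ?thesis using t by (simp add: alpha_theta_quadratic)
qed

text \<open>The multiplicity \<open>(\<Sum>j<k. p j) - k\<close> of the eigenvalue \<open>1\<close> outside \<open>bs\<close> may be negative: it then
  cancels surplus entries \<open>1\<close> of \<open>bs\<close>.\<close>

lemma diameter_4_spectrum:
  fixes p :: "nat \<Rightarrow> nat"
  assumes pe: "parent_enum G vs par"
    and len: "k < length vs"
    and par0: "\<And>j. 0 < j \<Longrightarrow> j \<le> k \<Longrightarrow> par j = 0"
    and par1: "\<And>j. k < j \<Longrightarrow> j < length vs \<Longrightarrow> 0 < par j \<and> par j \<le> k"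
    and p: "\<And>j. j < k \<Longrightarrow> p j = card {l. k < l \<and> l < length vs \<and> par l = Suc j}"
    and desc: "\<And>i j. i \<le> j \<Longrightarrow> j < k \<Longrightarrow> p j \<le> p i"
  shows "\<exists>bs. length vs = 1 + k + (\<Sum>j<k. p j) \<and>
    interlaced bs (branch_poles p k) \<and>
    (\<forall>x. x \<notin> set (branch_poles p k) \<longrightarrow>
       (\<Prod>b\<leftarrow>bs. x - b) = (\<Prod>a\<leftarrow>branch_poles p k. x - a) * secular p k x) \<and>
    sum_list bs = 3 * real k + (\<Sum>j<k. p j) \<and>
    (\<forall>g :: real \<Rightarrow> real. (\<Sum>\<mu>\<in>#proots (char_poly (laplacian_mat G vs)). g \<mu>)
       = (\<Sum>b\<leftarrow>bs. g b) + (real (\<Sum>j<k. p j) - k) * g 1)"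
proof -
  let ?n = "length vs" and ?s = "\<Sum>j<k. p j"
  let ?chi = "char_poly (laplacian_mat G vs)"
  \<comment> \<open>Reversing the \<open>theta\<close> part makes the diagonal entries ascend when
    \<open>p\<close> descends, as the interlacing theorem demands.\<close>
  define ps where "ps = map (\<lambda>j. (alpha (p j), 1 / (theta (p j) + 1))) [0..<k]
    @ rev (map (\<lambda>j. (theta (p j), theta (p j) / (theta (p j) + 1))) [0..<k])"
  have fst_ps: "map fst ps = branch_poles p k"
    by (simp add: ps_def branch_poles_def rev_map[symmetric] comp_def)
  have "0 < theta q + 1" for q using theta_ge(3)[of q] by linarith
  then have w: "0 \<le> v" if "(a, v) \<in> set ps" for a v
    using that theta_ge(3) by (auto simp: ps_def intro!: divide_nonneg_nonneg intro: less_imp_le)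
  have "sorted (map fst ps)" unfolding fst_ps by (rule sorted_branch_poles) (rule desc)
  then have "\<exists>bs. interlaced bs (map fst ps) \<and> arrow_poly k ps = monic_prod bs"
    by (rule arrow_poly_interlaced) (rule w)
  then obtain bs where bs: "interlaced bs (branch_poles p k)" "arrow_poly k ps = monic_prod bs"
    unfolding fst_ps by blast
  have "(\<Sum>a\<leftarrow>branch_poles p k. a) = (\<Sum>j<k. alpha (p j) + theta (p j))"
    by (simp add: branch_poles_def sum_list_rev interv_sum_list_conv_sum_set_nat atLeast0LessThan sum.distrib)
  also have "\<dots> = 2 * real k + ?s" by (simp add: alpha_theta(1) sum.distrib)
  finally have sum_bs: "sum_list bs = 3 * real k + ?s"
    using arrow_poly_roots_sum[OF bs(2)] fst_ps by simp
  have val: "poly (monic_prod bs) x = poly (monic_prod (branch_poles p k)) x * secular p k x"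
    if x: "x \<notin> set (branch_poles p k)" for x
  proof -
    have "(\<Sum>(a, w)\<leftarrow>ps. w / (x - a)) = (\<Sum>j<k. 1 / (theta (p j) + 1) / (x - alpha (p j))
        + theta (p j) / (theta (p j) + 1) / (x - theta (p j)))"
      by (simp add: ps_def sum_list_rev rev_map[symmetric] comp_def interv_sum_list_conv_sum_set_nat
          atLeast0LessThan sum.distrib)
    also have "\<dots> = (\<Sum>j<k. (x - 1) / (x\<^sup>2 - (real (p j) + 2) * x + 1))"
    proof (rule sum.cong[OF refl])
      fix j assume "j \<in> {..<k}"
      then have "x \<noteq> alpha (p j)" "x \<noteq> theta (p j)" using x by (auto simp: branch_poles_def)
      then show "1 / (theta (p j) + 1) / (x - alpha (p j)) + theta (p j) / (theta (p j) + 1) / (x - theta (p j))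
          = (x - 1) / (x\<^sup>2 - (real (p j) + 2) * x + 1)"
        by (rule branch_partial_fractions)
    qed
    finally show ?thesis
      using poly_arrow_poly[of x ps "real k"] x bs(2) fst_ps by (simp add: secular_def)
  qed
  have children: "{l. 0 < l \<and> l < ?n \<and> par l = 0} = {0<..k}"
    "j < k \<Longrightarrow> {l. 0 < l \<and> l < ?n \<and> par l = Suc j} = {l. k < l \<and> l < ?n \<and> par l = Suc j}"
    "k < i \<Longrightarrow> {l. 0 < l \<and> l < ?n \<and> par l = i} = {}" for i j
  proof -
    have cases: "l \<le> k \<and> par l = 0 \<or> k < l \<and> 0 < par l \<and> par l \<le> k" if "0 < l" "l < ?n" for l
      using par0[of l] par1[of l] that by (cases "l \<le> k") simp_all
    show "{l. 0 < l \<and> l < ?n \<and> par l = 0} = {0<..k}"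
    proof (rule Set.set_eqI)
      show "l \<in> {l. 0 < l \<and> l < ?n \<and> par l = 0} \<longleftrightarrow> l \<in> {0<..k}" for l
        using cases[of l] len by auto
    qed
    show "{l. 0 < l \<and> l < ?n \<and> par l = Suc j} = {l. k < l \<and> l < ?n \<and> par l = Suc j}" if "j < k"
    proof (rule Collect_cong)
      show "0 < l \<and> l < ?n \<and> par l = Suc j \<longleftrightarrow> k < l \<and> l < ?n \<and> par l = Suc j" for l
        using cases[of l] by auto
    qed
    show "{l. 0 < l \<and> l < ?n \<and> par l = i} = {}" if "k < i"
    proof -
      have "par l \<noteq> i" if "0 < l" "l < ?n" for l
        using cases[of l] that \<open>k < i\<close> by auto
      then show ?thesis by blast
    qed
  qed
  have "?s = (\<Sum>j<k. card {l. k < l \<and> l < ?n \<and> par l = Suc j})" using p by simp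
  also have "\<dots> = card (\<Union>j<k. {l. k < l \<and> l < ?n \<and> par l = Suc j})"
    by (rule card_UN_disjoint[symmetric]) auto
  also have "(\<Union>j<k. {l. k < l \<and> l < ?n \<and> par l = Suc j}) = {k<..<?n}"
  proof (intro equalityI subsetI)
    fix l assume l: "l \<in> {k<..<?n}"
    then have "Suc (par l - 1) = par l" "par l - 1 < k" using par1[of l] by auto
    then show "l \<in> (\<Union>j<k. {l. k < l \<and> l < ?n \<and> par l = Suc j})"
      using l by (intro UN_I[of "par l - 1"]) auto
  qed auto
  finally have n: "?n = 1 + k + ?s" using len by simp
  \<comment> \<open>The factor \<open>(x - 1) ^ k\<close> clears the denominators of the
    \<open>k\<close> branch pivots. The excluded points are those where a pivot of a leaf or of a
    neighbour of the centre vanishes.\<close>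
  have chi: "poly (?chi * [:-1, 1:] ^ k) x = poly (monic_prod bs * [:-1, 1:] ^ ?s) x"
    if x: "x \<notin> insert 1 (set (branch_poles p k))" for x
  proof -
    define q where "q j = x\<^sup>2 - (real (p j) + 2) * x + 1" for j
    have q_nz: "q j \<noteq> 0" if "j < k" for j
      using x that unfolding q_def alpha_theta_quadratic[symmetric] by (auto simp: branch_poles_def)
    have x1: "x - 1 \<noteq> 0" using x by auto
    \<comment> \<open>A leaf has pivot \<open>x - 1\<close>; a neighbour of the centre has degree
      \<open>p j + 1\<close> and \<open>p j\<close> leaf children, which gives
      \<open>x - (1 + p j) - p j / (x - 1) = q j / (x - 1)\<close>; the centre then gets the secular
      function.\<close>
    define a where "a i = (if i = 0 then secular p k x else if i \<le> k then q (i - 1) / (x - 1) else x - 1)" for i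
    have "poly ?chi x = (\<Prod>i<?n. a i)"
    proof (rule parent_enum_poly_char_poly[OF pe])
      show "a i \<noteq> 0" if "0 < i" "i < ?n" for i
        using that x1 q_nz[of "i - 1"] by (auto simp: a_def)
      fix i assume i: "i < ?n"
      consider "i = 0" | j where "i = Suc j" "j < k" | "k < i"
        by (cases "i \<le> k"; cases i) auto
      then show "a i = x - real (out_degree (with_proj G) (vs ! i))
          - (\<Sum>l | 0 < l \<and> l < ?n \<and> par l = i. 1 / a l)"
      proof cases
        case 1
        have "(\<Sum>l\<in>{0<..k}. 1 / a l) = (\<Sum>j<k. (x - 1) / q j)"
          by (rule sum.reindex_bij_witness[of _ Suc "\<lambda>i. i - 1"]) (auto simp: a_def)
        then show ?thesis
          using 1 i by (simp add: parent_enum_out_degree[OF pe] children a_def secular_def q_def)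
      next
        case 2
        have "(\<Sum>l | k < l \<and> l < ?n \<and> par l = Suc j. 1 / a l) = p j * (1 / (x - 1))"
          using p[OF 2(2)] by (simp add: a_def)
        moreover have "q j / (x - 1) = x - (1 + p j) - p j / (x - 1)"
          using x1 by (simp add: q_def divide_simps) (simp add: algebra_simps power2_eq_square)
        ultimately show ?thesis
          using 2 i p[OF 2(2)] by (simp add: parent_enum_out_degree[OF pe] children a_def)
      next
        case 3
        then show ?thesis using i by (simp add: parent_enum_out_degree[OF pe] children a_def)
      qed
    qed
    also have "{..<?n} = insert 0 (Suc ` {..<k} \<union> {k<..<?n})"
    proof (rule Set.set_eqI)
      show "i \<in> {..<?n} \<longleftrightarrow> i \<in> insert 0 (Suc ` {..<k} \<union> {k<..<?n})" for i
        using len by (cases i) auto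
    qed
    also have "(\<Prod>i\<in>\<dots>. a i) = secular p k x * ((\<Prod>j<k. q j / (x - 1)) * (x - 1) ^ ?s)"
    proof -
      have "prod a (insert 0 (Suc ` {..<k} \<union> {k<..<?n})) = a 0 * prod a (Suc ` {..<k} \<union> {k<..<?n})"
        by (rule prod.insert) auto
      also have "prod a (Suc ` {..<k} \<union> {k<..<?n}) = prod a (Suc ` {..<k}) * prod a {k<..<?n}"
        by (rule prod.union_disjoint) auto
      also have "prod a (Suc ` {..<k}) = (\<Prod>j<k. q j / (x - 1))"
        by (subst prod.reindex) (auto simp: a_def)
      also have "prod a {k<..<?n} = (\<Prod>i\<in>{k<..<?n}. x - 1)"
        by (intro prod.cong) (auto simp: a_def)
      also have "\<dots> = (x - 1) ^ ?s" using n by simp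
      finally show ?thesis by (simp add: a_def)
    qed
    also have "(\<Prod>j<k. q j / (x - 1)) = (\<Prod>j<k. q j) / (x - 1) ^ k"
      by (simp add: prod_dividef)
    also have "(\<Prod>j<k. q j) = (\<Prod>j<k. (x - alpha (p j)) * (x - theta (p j)))"
      by (simp add: q_def alpha_theta_quadratic)
    also have "\<dots> = poly (monic_prod (branch_poles p k)) x"
      by (simp add: poly_monic_prod branch_poles_def prod.distrib rev_map[symmetric] comp_def
          prod_list.rev atLeast0LessThan flip: prod.distinct_set_conv_list)
    finally have "poly ?chi x * (x - 1) ^ k
        = secular p k x * poly (monic_prod (branch_poles p k)) x * (x - 1) ^ ?s"
      using x1 by simp
    then show ?thesis using val[of x] x by (simp add: poly_power ac_simps)
  qed
  have "?chi * [:-1, 1:] ^ k = monic_prod bs * [:-1, 1:] ^ ?s"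
    by (rule poly_eqI_cofinite[of "insert 1 (set (branch_poles p k))", OF _ chi]) auto
  moreover have "proots (monic_prod bs * [:-1, 1:] ^ ?s) = mset bs + replicate_mset ?s 1"
    by (subst proots_mult) (simp_all add: proots_power proots_monic_prod)
  moreover have "proots (?chi * [:-1, 1:] ^ k) = proots ?chi + replicate_mset k 1"
  proof (rule trans[OF proots_mult])
    have "monic_prod bs * [:-1, 1:] ^ ?s \<noteq> 0" by simp
    then show "?chi \<noteq> 0" using calculation by auto
  qed (simp_all add: proots_power)
  ultimately have roots: "proots ?chi + replicate_mset k 1 = mset bs + replicate_mset ?s (1 :: real)"
    by simp
  have sums: "(\<Sum>\<mu>\<in>#proots ?chi. g \<mu>) + k * g 1 = (\<Sum>b\<leftarrow>bs. g b) + ?s * g 1" for g :: "real \<Rightarrow> real"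
  proof -
    have "(\<Sum>\<mu>\<in>#proots ?chi + replicate_mset k 1. g \<mu>)
        = (\<Sum>\<mu>\<in>#mset bs + replicate_mset ?s 1. g \<mu>)"
      unfolding roots ..
    then show ?thesis by (simp flip: sum_mset_sum_list)
  qed
  have "(\<Sum>\<mu>\<in>#proots ?chi. g \<mu>) = (\<Sum>b\<leftarrow>bs. g b) + (real ?s - k) * g 1" for g :: "real \<Rightarrow> real"
    using sums[of g] by (simp add: algebra_simps)
  then show ?thesis
    using n bs(1) sum_bs val by (intro exI[of _ bs]) (simp add: poly_monic_prod)
qed

section \<open>Paths and stars\<close>

text \<open>The difference vanishes at 0 and has a nonnegative derivative, by
  \<open>cos y \<ge> 1 - y\<^sup>2 / 2\<close>. The latter is the half-angle formula with
  \<open>\<bar>sin (y / 2)\<bar> \<le> y / 2\<close>.\<close>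

lemma sin_ge_cubic:
  fixes x :: real
  assumes "0 \<le> x"
  shows "x - x ^ 3 / 6 \<le> sin x"
proof -
  have cos_ge: "1 - y\<^sup>2 / 2 \<le> cos y" if "0 \<le> y" for y :: real
  proof -
    have "0 \<le> sin (y / 2) \<or> 2 \<le> y"
      using that pi_ge_two by (cases "y < 2") (auto intro!: sin_ge_zero)
    then have "\<bar>sin (y / 2)\<bar> \<le> y / 2"
    proof
      assume "0 \<le> sin (y / 2)"
      then show ?thesis using sin_x_le_x[of "y / 2"] that by simp
    next
      assume "2 \<le> y"
      then show ?thesis using abs_sin_le_one[of "y / 2"] by linarith
    qed
    then have "(sin (y / 2))\<^sup>2 \<le> (y / 2)\<^sup>2" by (simp add: abs_le_square_iff[symmetric] that)
    then show ?thesis using cos_double_sin[of "y / 2"] by (simp add: power_divide)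
  qed
  have "(\<lambda>x. sin x - x + x ^ 3 / 6) 0 \<le> (\<lambda>x. sin x - x + x ^ 3 / 6) x"
  proof (rule DERIV_nonneg_imp_nondecreasing[OF assms])
    fix y :: real assume "0 \<le> y"
    have "((\<lambda>x. sin x - x + x ^ 3 / 6) has_real_derivative (cos y - 1 + y\<^sup>2 / 2)) (at y)"
      by (auto intro!: derivative_eq_intros)
    then show "\<exists>d. ((\<lambda>x. sin x - x + x ^ 3 / 6) has_real_derivative d) (at y) \<and> 0 \<le> d"
      using cos_ge[OF \<open>0 \<le> y\<close>] by force
  qed
  then show ?thesis by simp
qed

definition path_eigval :: "nat \<Rightarrow> nat \<Rightarrow> real" where
  "path_eigval n j = 2 - 2 * cos (pi * j / n)"

text \<open>The eigenvector samples a cosine at half-integers. Its continuation is symmetric about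
  both ends of the path, so the missing neighbour of an end vertex would carry the same value as
  that vertex, and the rows of degree 1 obey the same recurrence as the inner ones.\<close>

lemma path_graph_eigenvalue:
  assumes "j < n"
  shows "eigenvalue (laplacian_mat (path_graph n) [0..<n]) (path_eigval n j)"
proof -
  let ?L = "laplacian_mat (path_graph n) [0..<n]"
  define f where "f = pi * j / (2 * n)"
  define w where "w i = cos ((2 * real i + 1) * f)" for i
  let ?v = "Matrix.vec n w"
  have L: "?L \<in> carrier_mat n n"
    by (auto simp: laplacian_mat_def degree_mat_def adjacency_mat_def intro!: minus_carrier_mat)
  have "0 \<le> f" "f < pi / 2" using assms by (auto simp: f_def field_simps)
  then have "0 < w 0" unfolding w_def by (intro cos_gt_zero_pi) auto
  moreover have "vec_index ?v 0 = w 0" "vec_index (0\<^sub>v n :: real Matrix.vec) 0 = 0" using assms by simp_all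
  ultimately have "?v \<noteq> 0\<^sub>v n" by auto
  moreover have "?L *\<^sub>v ?v = path_eigval n j \<cdot>\<^sub>v ?v"
  proof (rule eq_vecI)
    fix i assume "i < dim_vec (path_eigval n j \<cdot>\<^sub>v ?v)"
    then have i: "i < n" by simp
    have entry: "?L $$ (i, l) = (if l = i then real (out_degree (with_proj (path_graph n)) i) else 0)
        - (if l = i + 1 then 1 else 0) - (if i = l + 1 then 1 else 0)" if "l < n" for l
      using that i by (auto simp: laplacian_mat_def degree_mat_def adjacency_mat_def path_graph_def)
    have "{l. 0 < l \<and> l < n \<and> l - 1 = i} = (if i + 1 < n then {i + 1} else {})" by auto
    then have deg: "real (out_degree (with_proj (path_graph n)) i)
        = (if 0 < i then 1 else 0) + (if i + 1 < n then 1 else 0)"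
      using parent_enum_out_degree[OF parent_enum_path_graph[of n], of i] i by (simp split: if_splits)
    have "(?L *\<^sub>v ?v) $ i = (\<Sum>l<n. ?L $$ (i, l) * w l)"
      using L i by (simp add: scalar_prod_def atLeast0LessThan)
    also have "\<dots> = (\<Sum>l<n. (if l = i then real (out_degree (with_proj (path_graph n)) i) * w i else 0)
        - (if l = i + 1 then w (i + 1) else 0) - (if l = i - 1 then if 0 < i then w (i - 1) else 0 else 0))"
      by (intro sum.cong) (auto simp: entry algebra_simps)
    also have "\<dots> = real (out_degree (with_proj (path_graph n)) i) * w i
        - (if i + 1 < n then w (i + 1) else 0) - (if 0 < i then w (i - 1) else 0)"
      using i by (simp add: sum_subtractf)
    also have "\<dots> = 2 * w i - cos ((2 * real i + 1) * f + 2 * f) - cos ((2 * real i + 1) * f - 2 * f)"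
    proof -
      have w1: "cos ((2 * real i + 1) * f + 2 * f) = w (i + 1)"
        by (simp add: w_def algebra_simps)
      have w2: "cos ((2 * real i + 1) * f + 2 * f) = w i" if "i + 1 = n"
      proof -
        have "2 * real n * f = pi * real j" using assms by (simp add: f_def)
        moreover have rn: "real i = real n - 1" using that by linarith
        have "(2 * real i + 1) * f + 2 * f = 2 * real n * f + f"
          "(2 * real i + 1) * f = 2 * real n * f - f"
          unfolding rn by (simp_all add: algebra_simps)
        ultimately have "(2 * real i + 1) * f + 2 * f = pi * real j + f"
          "(2 * real i + 1) * f = pi * real j - f"
          by simp_all
        then show ?thesis by (simp add: w_def cos_add cos_diff)
      qed
      have w3: "cos ((2 * real i + 1) * f - 2 * f) = w (i - 1)" if "0 < i"
        using that by (simp add: w_def of_nat_diff algebra_simps)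
      have w4: "cos ((2 * real i + 1) * f - 2 * f) = w i" if "i = 0"
        using that by (simp add: w_def)
      have "cos ((2 * real i + 1) * f + 2 * f) = (if i + 1 < n then w (i + 1) else w i)"
        using w1 w2 i by (cases "i + 1 < n") simp_all
      moreover have "cos ((2 * real i + 1) * f - 2 * f) = (if 0 < i then w (i - 1) else w i)"
        using w3 w4 by (cases "0 < i") simp_all
      ultimately show ?thesis by (simp only: deg) simp
    qed
    also have "\<dots> = path_eigval n j * w i"
    proof -
      have "2 * f = pi * j / n" by (simp add: f_def)
      then have "path_eigval n j = 2 - 2 * cos (2 * f)" by (simp add: path_eigval_def)
      moreover have "cos (x + y) + cos (x - y) = 2 * cos x * cos y" for x y :: real
        by (simp add: cos_add cos_diff)
      note this[of "(2 * real i + 1) * f" "2 * f"]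
      moreover have "2 * A - X - Y = P * A" if "P = 2 - 2 * B" "X + Y = 2 * A * B" for A B X Y P :: real
      proof -
        have "2 * A - X - Y = 2 * A - 2 * A * B" using that(2) by linarith
        also have "\<dots> = P * A" unfolding that(1) by (simp add: algebra_simps)
        finally show ?thesis .
      qed
      ultimately show ?thesis unfolding w_def by blast
    qed
    finally show "(?L *\<^sub>v ?v) $ i = (path_eigval n j \<cdot>\<^sub>v ?v) $ i" using i by simp
  qed (use L in auto)
  ultimately show ?thesis
    unfolding eigenvalue_def eigenvector_def using L by (intro exI[of _ ?v]) auto
qed

text \<open>Cosine is injective on \<open>[0, pi]\<close>, so the \<open>n\<close> eigenvalues found
  are distinct and determine a monic polynomial of degree \<open>n\<close>.\<close>

lemma path_graph_char_poly:
  "char_poly (laplacian_mat (path_graph n) [0..<n]) = monic_prod (map (path_eigval n) [0..<n])"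
proof -
  let ?L = "laplacian_mat (path_graph n) [0..<n]"
  have L: "?L \<in> carrier_mat n n"
    by (auto simp: laplacian_mat_def degree_mat_def adjacency_mat_def intro!: minus_carrier_mat)
  have "inj_on (path_eigval n) {..<n}"
  proof (rule inj_onI)
    fix i j assume ij: "i \<in> {..<n}" "j \<in> {..<n}" "path_eigval n i = path_eigval n j"
    have "pi * i / n = pi * j / n"
      by (rule cos_inj_pi) (use ij in \<open>auto simp: path_eigval_def field_simps\<close>)
    then show "i = j" using ij by (auto simp: field_simps)
  qed
  then have card: "card (path_eigval n ` {..<n}) = n" by (simp add: card_image)
  show ?thesis
  proof (rule poly_eqI_degree_lead_coeff[where A = "path_eigval n ` {..<n}" and n = n])
    show "coeff (char_poly ?L) n = coeff (monic_prod (map (path_eigval n) [0..<n])) n"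
      using degree_monic_char_poly[OF L] lead_coeff_monic_prod[of "map (path_eigval n) [0..<n]"] by simp
    show "poly (char_poly ?L) z = poly (monic_prod (map (path_eigval n) [0..<n])) z"
      if z: "z \<in> path_eigval n ` {..<n}" for z
    proof -
      have "poly (char_poly ?L) z = 0"
        using z path_graph_eigenvalue eigenvalue_root_char_poly[OF L] by auto
      moreover have "poly (monic_prod (map (path_eigval n) [0..<n])) z = 0"
        by (rule poly_monic_prod_at_root) (use z in auto)
      ultimately show ?thesis by simp
    qed
  qed (use card degree_monic_char_poly[OF L] in auto)
qed

text \<open>After multiplication by \<open>2 * sin f\<close> the sum telescopes.\<close>

lemma sum_cos_multiples:
  "2 * sin f * (\<Sum>j<m. cos (2 * real j * f)) = sin (2 * real m * f - f) + sin f"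
proof (induction m)
  case (Suc m)
  have "2 * sin f * cos (2 * real m * f) = sin (2 * real m * f + f) - sin (2 * real m * f - f)"
    by (simp add: sin_add sin_diff)
  moreover have "2 * real (Suc m) * f - f = 2 * real m * f + f" by (simp add: algebra_simps)
  ultimately show ?case
    by (simp only: sum.lessThan_Suc distrib_left Suc.IH)
qed simp

text \<open>The first bound only has to exceed \<open>1 / n\<close>, which fixes the signs of the
  deviations in the path. The second is nearly sharp: 0.644 is slightly above \<open>2 / pi\<close>.
  In the proof, 0.32 and 0.23 round up \<open>pi / 10\<close> and \<open>pi / 14\<close>, the
  largest arguments that occur.\<close>

lemma sin_pi_over_ge:
  assumes "5 \<le> n"
  shows "3 / (2 * real n) \<le> sin (pi / (2 * real n))"
    and "7 \<le> n \<Longrightarrow> 1 / (0.644 * real n) \<le> sin (pi / (2 * real n))"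
proof -
  let ?x = "pi / (2 * real n)"
  have pi: "3.14 \<le> pi" "pi \<le> 3.15" using pi_approx by simp_all
  have x: "0 \<le> ?x" "?x - ?x ^ 3 / 6 = ?x * (1 - ?x\<^sup>2 / 6)" "3.14 / (2 * real n) \<le> ?x"
  proof -
    show "3.14 / (2 * real n) \<le> ?x" by (rule divide_right_mono) (use pi in auto)
  qed (simp_all add: power3_eq_cube power2_eq_square algebra_simps)
  have *: "3.14 / (2 * real n) * (1 - c\<^sup>2 / 6) \<le> sin ?x" if "?x \<le> c" "c \<le> 1" for c
  proof -
    have "0 \<le> c" using that x(1) by linarith
    then have c2: "?x\<^sup>2 \<le> c\<^sup>2" "c\<^sup>2 \<le> 1"
      using power_mono[OF that(1) x(1)] power_le_one[OF _ that(2)] by simp_all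
    have "3.14 / (2 * real n) * (1 - c\<^sup>2 / 6) \<le> ?x * (1 - ?x\<^sup>2 / 6)"
      using x c2 by (intro mult_mono) auto
    then show ?thesis using sin_ge_cubic[OF x(1)] x(2) by simp
  qed
  have "?x \<le> 0.32" using assms pi by (simp add: field_simps)
  then have "3.14 / (2 * real n) * (1 - 0.32\<^sup>2 / 6) \<le> sin ?x" by (rule *) simp
  moreover have "3 / (2 * real n) \<le> 3.14 / (2 * real n) * (1 - 0.32\<^sup>2 / 6)"
    using assms by (simp add: field_simps)
  ultimately show "3 / (2 * real n) \<le> sin ?x" by linarith
  assume "7 \<le> n"
  then have "?x \<le> 0.23" using pi by (simp add: field_simps)
  then have "3.14 / (2 * real n) * (1 - 0.23\<^sup>2 / 6) \<le> sin ?x" by (rule *) simp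
  moreover have "1 / (0.644 * real n) \<le> 3.14 / (2 * real n) * (1 - 0.23\<^sup>2 / 6)"
    using assms by (simp add: field_simps)
  ultimately show "1 / (0.644 * real n) \<le> sin ?x" by linarith
qed

text \<open>An eigenvalue lies below the mean exactly for \<open>j < J\<close>: up to there the
  cosines are at least \<open>sin f > 1 / n\<close>, and from \<open>J\<close> on they are not
  positive. With the signs known, the energy reduces to two cosine sums in closed form.\<close>

lemma laplacian_energy_path_graph:
  assumes "5 \<le> n"
  shows "odd n \<Longrightarrow> laplacian_energy (path_graph n) = 2 / sin (pi / (2 * real n)) - 2 / n"
    and "even n \<Longrightarrow> laplacian_energy (path_graph n) = 2 * cos (pi / (2 * real n)) / sin (pi / (2 * real n))"
proof -
  define f where "f = pi / (2 * real n)"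
  define J where "J = (n + 1) div 2"
  define c where "c j = cos (2 * real j * f)" for j
  have f: "0 < f" "f < pi / 2" "2 * real n * f = pi"
    using assms by (auto simp: f_def field_simps)
  have sin_f: "0 < sin f" using f by (intro sin_gt_zero2) auto
  have "proots (char_poly (laplacian_mat (path_graph n) [0..<n])) = mset (map (path_eigval n) [0..<n])"
    unfolding path_graph_char_poly by (rule proots_monic_prod)
  then have "laplacian_energy (path_graph n)
      = (\<Sum>\<mu>\<in>#mset (map (path_eigval n) [0..<n]). \<bar>\<mu> - (2 - 2 / real n)\<bar>)"
    using parent_enum_laplacian_energy[OF parent_enum_path_graph, of n] assms by simp
  also have "\<dots> = (\<Sum>j<n. \<bar>path_eigval n j - (2 - 2 / n)\<bar>)"
    by (simp add: sum_mset_sum_list[symmetric] atLeast0LessThan sum_unfold_sum_mset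
        image_mset.compositionality comp_def)
  also have "\<dots> = (\<Sum>j<n. \<bar>2 / n - 2 * c j\<bar>)"
    by (intro sum.cong) (auto simp: path_eigval_def c_def f_def ac_simps)
  also have "\<dots> = (\<Sum>j<n. (2 / n - 2 * c j) + (if j < J then 2 * (2 * c j - 2 / n) else 0))"
  proof (intro sum.cong refl)
    fix j assume "j \<in> {..<n}"
    then have j: "j < n" by simp
    show "\<bar>2 / n - 2 * c j\<bar> = (2 / n - 2 * c j) + (if j < J then 2 * (2 * c j - 2 / n) else 0)"
    proof (cases "j < J")
      case True
      then have "real (2 * j + 1) \<le> real n" unfolding J_def by (subst of_nat_le_iff) presburger
      then have "real (2 * j + 1) * f \<le> real n * f" using f by (intro mult_right_mono) auto
      then have "2 * real j * f \<le> pi / 2 - f" using f(3) by (simp add: algebra_simps)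
      then have "sin f \<le> c j"
        unfolding c_def sin_cos_eq using f by (intro cos_monotone_0_pi_le) auto
      moreover have "3 / (2 * real n) \<le> sin f" using sin_pi_over_ge(1)[OF assms] by (simp add: f_def)
      moreover have "1 / real n \<le> 3 / (2 * real n)" using assms by (simp add: field_simps)
      ultimately show ?thesis using True by simp
    next
      case False
      then have "real n \<le> real (2 * j)" unfolding J_def by (subst of_nat_le_iff) presburger
      then have "real n * f \<le> real (2 * j) * f" using f by (intro mult_right_mono) auto
      then have "pi / 2 \<le> 2 * real j * f" using f(3) by simp
      moreover have "2 * real j * f \<le> pi"
        using j f mult_right_mono[of "2 * real j" "2 * real n" f] by simp
      ultimately have "c j \<le> cos (pi / 2)"
        unfolding c_def by (intro cos_monotone_0_pi_le) auto
      moreover have "0 \<le> 2 / real n" by simp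
      ultimately have "0 \<le> 2 / real n - 2 * c j" unfolding cos_pi_half by linarith
      then show ?thesis using False by simp
    qed
  qed
  also have "\<dots> = 2 - 2 * (\<Sum>j<n. c j) + (\<Sum>j<J. 2 * (2 * c j - 2 / n))"
  proof -
    have "{..<n} \<inter> {j. j < J} = {..<J}" using assms by (auto simp: J_def)
    then show ?thesis
      using assms by (simp add: sum.distrib sum_subtractf sum_distrib_left[symmetric] sum.If_cases)
  qed
  also have "(\<Sum>j<n. c j) = 1"
  proof -
    have "sin (2 * real n * f - f) = sin f" using f(3) by simp
    then have "2 * sin f * (\<Sum>j<n. c j) = 2 * sin f * 1"
      using sum_cos_multiples[of f n] by (simp add: c_def)
    then show ?thesis using sin_f by (simp only: mult_cancel_left) auto
  qed
  also have "(\<Sum>j<J. 2 * (2 * c j - 2 / n)) = 4 * (\<Sum>j<J. c j) - 4 * real J / n"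
  proof -
    have "(\<Sum>j<J. 2 * (2 * c j - 2 / n)) = (\<Sum>j<J. 4 * c j - 4 / n)"
      by (intro sum.cong) auto
    then show ?thesis by (simp add: sum_subtractf sum_distrib_left)
  qed
  also have "(\<Sum>j<J. c j) = (sin (2 * real J * f - f) / sin f + 1) / 2"
    using sum_cos_multiples[of f J] sin_f by (simp add: c_def field_simps)
  finally have E: "laplacian_energy (path_graph n)
      = 2 * sin (2 * real J * f - f) / sin f + 2 - 4 * real J / n"
    by simp
  show "laplacian_energy (path_graph n) = 2 / sin (pi / (2 * real n)) - 2 / n" if "odd n"
  proof -
    have "2 * J = n + 1" using that by (auto simp: J_def)
    then have J: "2 * real J = real n + 1" by linarith
    have "2 * real J * f - f = pi / 2" unfolding J using f(3) by (simp add: algebra_simps)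
    then show ?thesis unfolding E using J assms by (simp add: f_def field_simps)
  qed
  show "laplacian_energy (path_graph n) = 2 * cos (pi / (2 * real n)) / sin (pi / (2 * real n))" if "even n"
  proof -
    have "2 * J = n" using that by (auto simp: J_def)
    then have J: "2 * real J = real n" by linarith
    have "2 * real J * f - f = pi / 2 - f" unfolding J using f(3) by (simp add: algebra_simps)
    then have "sin (2 * real J * f - f) = cos f" by (simp only: cos_sin_eq of_real_eq_id id_apply)
    moreover have "4 * real J / n = 2" using J assms by (simp add: field_simps)
    ultimately show ?thesis unfolding E by (simp add: f_def)
  qed
qed

text \<open>Needed for the exact energy of the path on 5 vertices. The angles \<open>3 * t\<close>
  and \<open>2 * t\<close> are complementary, and \<open>cos (3 * t) = sin (2 * t)\<close> divided
  by \<open>cos t\<close> is a quadratic equation for \<open>sin t\<close>.\<close>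

lemma sin_pi_10: "sin (pi / 10) = (sqrt 5 - 1) / 4"
proof -
  define t where "t = pi / 10"
  let ?s = "sin t" and ?c = "cos t"
  have c: "0 < ?c" and s: "0 < ?s" by (auto simp: t_def intro!: cos_gt_zero sin_gt_zero)
  have "cos (3 * t) = sin (2 * t)" by (simp add: t_def sin_cos_eq)
  then have "4 * ?c ^ 3 - 3 * ?c = 2 * ?s * ?c"
    using cos_treble_cos[of t] sin_double[of t] by simp
  then have "?c * (4 * ?c\<^sup>2 - 3) = ?c * (2 * ?s)"
    by (simp add: power3_eq_cube power2_eq_square algebra_simps)
  then have "4 * ?c\<^sup>2 - 3 = 2 * ?s" using c by simp
  then have "4 * ?s\<^sup>2 + 2 * ?s = 1" using cos_squared_eq[of t] by simp
  moreover have "(4 * ?s + 1)\<^sup>2 = 4 * (4 * ?s\<^sup>2 + 2 * ?s) + 1"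
    by (simp add: power2_eq_square algebra_simps)
  ultimately have "(4 * ?s + 1)\<^sup>2 = 5" by simp
  then have "4 * ?s + 1 = sqrt 5" using s by (intro real_sqrt_unique[symmetric]) auto
  then show ?thesis by (simp add: t_def)
qed

text \<open>Half of the energy of the path on 6 vertices, by the double-angle formulas at
  \<open>pi / 6\<close>.\<close>

lemma cot_pi_12: "cos (pi / 12) / sin (pi / 12) = 2 + sqrt 3"
proof -
  have s: "0 < sin (pi / 12)" by (intro sin_gt_zero) auto
  have "cos (pi / 6) = 2 * (cos (pi / 12))\<^sup>2 - 1" "sin (pi / 6) = 2 * sin (pi / 12) * cos (pi / 12)"
    using cos_double_cos[of "pi / 12"] sin_double[of "pi / 12"] by simp_all
  then have "2 * (cos (pi / 12))\<^sup>2 = 1 + sqrt 3 / 2" "4 * (sin (pi / 12) * cos (pi / 12)) = 1"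
    unfolding sin_30 cos_30 by linarith+
  then have "cos (pi / 12) * cos (pi / 12) = (2 + sqrt 3) / 4" "sin (pi / 12) * cos (pi / 12) = 1 / 4"
    by (simp_all add: power2_eq_square)
  then have "cos (pi / 12) * cos (pi / 12) = (2 + sqrt 3) * sin (pi / 12) * cos (pi / 12)"
    by (simp only: times_divide_eq_right mult_1_right mult.assoc)
  moreover have "cos (pi / 12) \<noteq> 0" using cos_gt_zero[of "pi / 12"] by simp
  ultimately have "cos (pi / 12) = (2 + sqrt 3) * sin (pi / 12)"
    by (metis mult_right_cancel)
  then show ?thesis using s by simp
qed

lemma laplacian_energy_star_graph:
  assumes "2 \<le> n"
  shows "laplacian_energy (star_graph n) = 2 * n - 4 + 4 / n"
proof -
  let ?chi = "char_poly (laplacian_mat (star_graph n) [0..<n])"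
  have "?chi = [:0, 1:] * [:- real n, 1:] * [:-1, 1:] ^ (n - 2)"
  proof (rule poly_eqI_cofinite[of "{1}"])
    fix x :: real assume "x \<notin> {1}"
    then have x: "x - 1 \<noteq> 0" by simp
    \<comment> \<open>Leaves have pivot \<open>x - 1\<close>, so the centre has
      \<open>x - (n - 1) - (n - 1) / (x - 1)\<close>, written here in factored form.\<close>
    define a where "a i = (if i = 0 then x * (x - n) / (x - 1) else x - 1)" for i :: nat
    have children: "{l. 0 < l \<and> l < n \<and> 0 = i} = (if i = 0 then {0<..<n} else {})"
      "{l. 0 < l \<and> l < n \<and> i = 0} = (if i = 0 then {0<..<n} else {})" for i :: nat
      by auto
    have Collect_less: "{j. 0 < j \<and> j < n} = {0<..<n}" by auto
    have "poly ?chi x = (\<Prod>i<length [0..<n]. a i)"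
    proof (rule parent_enum_poly_char_poly[OF parent_enum_star_graph])
      show "a i \<noteq> 0" if "0 < i" for i using that x by (simp add: a_def)
      fix i assume i: "i < length [0..<n]"
      have "(\<Sum>l\<in>{0<..<n}. 1 / a l) = (real n - 1) / (x - 1)"
        using assms by (simp add: a_def of_nat_diff)
      moreover have "x * (x - n) / (x - 1) = x - (real n - 1) - (real n - 1) / (x - 1)"
        using x by (simp add: divide_simps) (simp add: algebra_simps)
      ultimately show "a i = x - real (out_degree (with_proj (star_graph n)) ([0..<n] ! i))
          - (\<Sum>l | 0 < l \<and> l < length [0..<n] \<and> 0 = i. 1 / a l)"
        using i assms parent_enum_out_degree[OF parent_enum_star_graph[of n], of i]
        by (cases "i = 0") (simp_all add: children Collect_less of_nat_diff a_def)
    qed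
    also have "{..<length [0..<n]} = insert 0 {1..<n}" using assms by auto
    also have "(\<Prod>i\<in>\<dots>. a i) = x * (x - n) / (x - 1) * (x - 1) ^ (n - 1)"
      by (simp add: a_def)
    also have "\<dots> = x * (x - n) * (x - 1) ^ (n - 2)"
    proof -
      obtain m where "n = m + 2" using assms by (metis le_add_diff_inverse2)
      then show ?thesis using x by simp
    qed
    finally show "poly ?chi x = poly ([:0, 1:] * [:- real n, 1:] * [:-1, 1:] ^ (n - 2)) x"
      by (simp add: poly_power algebra_simps)
  qed simp
  also have "\<dots> = monic_prod (0 # real n # replicate (n - 2) 1)"
    by (simp add: monic_prod_def mult.assoc)
  finally have "proots ?chi = mset (0 # real n # replicate (n - 2) 1)"
    by (simp only: proots_monic_prod)
  then have "laplacian_energy (star_graph n)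
      = \<bar>0 - (2 - 2 / real n)\<bar> + \<bar>real n - (2 - 2 / n)\<bar> + real (n - 2) * \<bar>1 - (2 - 2 / n)\<bar>"
    using parent_enum_laplacian_energy[OF parent_enum_star_graph, of n] assms by simp
  moreover have "2 / real n \<le> 1" "0 \<le> 2 / real n" using assms by simp_all
  then have "\<bar>0 - (2 - 2 / real n)\<bar> = 2 - 2 / n" "\<bar>real n - (2 - 2 / n)\<bar> = n - (2 - 2 / n)"
    "\<bar>1 - (2 - 2 / real n)\<bar> = 1 - 2 / n"
    using assms by linarith+
  ultimately have "laplacian_energy (star_graph n) = n + (real n - 2) * (1 - 2 / n)"
    using assms by (simp only: of_nat_diff) simp
  then show ?thesis using assms by (simp add: field_simps)
qed

section \<open>The energy inequalities\<close>

text \<open>Both bounds see the tree only through these data. The first \<open>r\<close> neighbours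
  of the centre carry leaves, and \<open>2 \<le> r\<close> reflects diameter 4: a longest path
  passes through two such neighbours.\<close>

locale diameter_4_data =
  fixes p :: "nat \<Rightarrow> nat" and k n r :: nat and bs :: "real list"
  assumes n_eq: "n = 1 + k + (\<Sum>j<k. p j)"
    and r: "2 \<le> r" "r \<le> k"
    and p_pos: "\<And>j. j < r \<Longrightarrow> 1 \<le> p j"
    and p_zero: "\<And>j. r \<le> j \<Longrightarrow> j < k \<Longrightarrow> p j = 0"
    and interlaced: "interlaced bs (branch_poles p k)"
    and secular: "\<And>x. x \<notin> set (branch_poles p k) \<Longrightarrow>
       (\<Prod>b\<leftarrow>bs. x - b) = (\<Prod>a\<leftarrow>branch_poles p k. x - a) * secular p k x"
    and sum_bs: "sum_list bs = 3 * real k + (\<Sum>j<k. p j)"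
begin

abbreviation "a i \<equiv> branch_poles p k ! i"
abbreviation "b i \<equiv> bs ! i"

text \<open>\<open>d\<close> is the average degree, \<open>s\<close> the number of vertices at distance 2 from the centre, and \<open>z\<close> the
  number of leaves attached to the centre.\<close>

definition "s = (\<Sum>j<k. p j)"
definition "t = 1 - 2 / real n"
definition "d = 1 + t"
definition "z = k - r"
text \<open>The share of the root \<open>b i\<close> in half of the energy; an eigenvalue 1 has the
  share \<open>t\<close>.\<close>

definition "neg i = max 0 (d - b i)"

lemma sum_p: "(\<Sum>j<r. p j) = s"
proof -
  have "(\<Sum>j<k. p j) = (\<Sum>j<r. p j) + (\<Sum>j\<in>{r..<k}. p j)"
    using r by (simp add: sum.atLeastLessThan_concat lessThan_atLeast0)
  then show ?thesis using p_zero by (simp add: s_def)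
qed

lemma r_le_s: "r \<le> s"
proof -
  have "(\<Sum>j<r. 1) \<le> (\<Sum>j<r. p j)" by (rule sum_mono) (use p_pos in auto)
  then show ?thesis using sum_p by simp
qed

lemma n_real: "real n = 1 + real k + real s" "5 \<le> n" "2 * r + 1 \<le> n" "real k = real r + real z"
proof -
  have n: "n = 1 + k + s" using n_eq by (simp add: s_def)
  then show "real n = 1 + real k + real s" by simp
  show "5 \<le> n" "2 * r + 1 \<le> n" using n r r_le_s by simp_all
  show "real k = real r + real z" using r by (simp add: z_def of_nat_diff)
qed

lemma t_bounds: "3 / 5 \<le> t" "t < 1" "n * t = real n - 2" and d_bounds: "8 / 5 \<le> d" "d < 2"
  using n_real(2) by (simp_all add: t_def d_def field_simps)

lemma length_bs: "length bs = 2 * k + 1"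
  using interlaced by (simp add: interlaced_def)

lemma interlace: "i < 2 * k \<Longrightarrow> b i \<le> a i" "i < 2 * k \<Longrightarrow> a i \<le> b (Suc i)"
  using interlaced by (auto simp: interlaced_def)

lemma a_alpha: "i < k \<Longrightarrow> a i = alpha (p i)"
  and a_theta: "k \<le> i \<Longrightarrow> i < 2 * k \<Longrightarrow> a i = theta (p (2 * k - 1 - i))"
  by (simp_all add: branch_poles_nth)

text \<open>Each leaf at the centre gives two poles at 1, and these \<open>2 * z\<close> poles are
  consecutive. Below them lie \<open>r\<close> values of \<open>alpha\<close>, above them
  \<open>r\<close> values of \<open>theta\<close>.\<close>

lemma a_middle: "r \<le> i \<Longrightarrow> i < k + z \<Longrightarrow> a i = 1"
proof (cases "i < k")
  case False
  assume "i < k + z"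
  then have "r \<le> 2 * k - 1 - i" "2 * k - 1 - i < k" "i < 2 * k" using False r by (auto simp: z_def)
  then show ?thesis using False p_zero by (simp add: a_theta)
qed (simp add: a_alpha p_zero)

lemma a_low: "i < k + z \<Longrightarrow> 0 < a i \<and> a i \<le> 1"
  using a_middle[of i] a_alpha[of i] alpha_pos alpha_le_1 r by (cases "i < k") auto

lemma a_high: "k + z \<le> i \<Longrightarrow> i < 2 * k \<Longrightarrow> 2 < a i"
proof -
  assume i: "k + z \<le> i" "i < 2 * k"
  then have "1 \<le> p (2 * k - 1 - i)" using r by (intro p_pos) (auto simp: z_def)
  then have "2 < theta (p (2 * k - 1 - i))" using theta_ge(4)[of "p (2 * k - 1 - i)"] by simp
  then show ?thesis using i by (simp add: a_theta)
qed

lemma a_less_d: "i < k + z \<Longrightarrow> a i < d"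
  and d_less_a: "k + z \<le> i \<Longrightarrow> i < 2 * k \<Longrightarrow> d < a i"
  using a_low[of i] a_high[of i] d_bounds by auto

lemma a_first: "i < r \<Longrightarrow> a i \<le> alpha 1"
  using p_pos[of i] alpha_antimono[of 1 "p i"] r by (simp add: a_alpha)

lemma alpha_1: "alpha 1 = (3 - sqrt 5) / 2" "alpha 1 \<le> 0.382"
proof -
  show *: "alpha 1 = (3 - sqrt 5) / 2" by (simp add: alpha_def)
  have "2.236 \<le> sqrt 5" by (rule real_le_rsqrt) (simp add: power2_eq_square)
  then show "alpha 1 \<le> 0.382" unfolding * by simp
qed

lemma a_pos: "i < 2 * k \<Longrightarrow> 0 < a i"
  using a_low[of i] a_high[of i] by (cases "i < k + z") auto

text \<open>With exactly \<open>m\<close> poles below \<open>y\<close>, interlacing places every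
  root except \<open>b m\<close>. The product over the other roots and the product over the poles
  then have the same sign \<open>(-1) ^ (2 * k - m)\<close>, and dividing them out leaves
  \<open>y - b m\<close> and \<open>secular p k y\<close> with equal signs.\<close>

lemma secular_sign:
  assumes m: "m \<le> 2 * k" and lt: "\<And>i. i < m \<Longrightarrow> a i < y" and gt: "\<And>i. m \<le> i \<Longrightarrow> i < 2 * k \<Longrightarrow> y < a i"
  shows "y < b m \<longleftrightarrow> secular p k y < 0"
proof -
  let ?as = "branch_poles p k" and ?e = "2 * k - m"
  let ?P = "poly (monic_prod ?as) y" and ?Q = "poly (monic_prod (take m bs @ drop (Suc m) bs)) y"
  have "0 < (-1) ^ length (drop m ?as) * poly (monic_prod (take m ?as @ drop m ?as)) y"
    by (rule poly_monic_prod_sign) (use lt gt in \<open>auto simp: in_set_conv_nth\<close>)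
  then have P: "0 < (-1) ^ ?e * ?P" by simp
  have "0 < (-1) ^ length (drop (Suc m) bs) * ?Q"
  proof (rule poly_monic_prod_sign)
    fix x assume "x \<in> set (take m bs)"
    then obtain i where "i < m" "x = b i" using m length_bs by (auto simp: in_set_conv_nth)
    then show "x < y" using interlace(1)[of i] lt[of i] m by simp
  next
    fix x assume "x \<in> set (drop (Suc m) bs)"
    then obtain i where "i < 2 * k - m" "x = b (Suc (m + i))"
      using m length_bs by (auto simp: in_set_conv_nth)
    moreover from this have "m + i < 2 * k" by simp
    ultimately show "y < x" using interlace(2)[of "m + i"] gt[of "m + i"] by simp
  qed
  then have Q: "0 < (-1) ^ ?e * ?Q" using length_bs by simp
  have "y \<notin> set ?as"
  proof
    assume "y \<in> set ?as"
    then obtain i where "i < 2 * k" "y = a i" by (auto simp: in_set_conv_nth)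
    then show False using lt[of i] gt[of i] by (cases "i < m") auto
  qed
  then have "poly (monic_prod bs) y = ?P * secular p k y"
    using secular by (simp add: poly_monic_prod)
  moreover have "bs = take m bs @ b m # drop (Suc m) bs"
    using m length_bs by (simp add: id_take_nth_drop)
  then have "monic_prod bs = monic_prod (b m # take m bs @ drop (Suc m) bs)"
    by (intro monic_prod_mset_cong) (metis mset.simps(2) mset_append union_mset_add_mset_right)
  then have "poly (monic_prod bs) y = (y - b m) * ?Q"
    by (simp only: monic_prod_simps poly_mult) (simp add: algebra_simps)
  ultimately have "(y - b m) * ?Q = ?P * secular p k y" by simp
  then have "(-1) ^ ?e * ((y - b m) * ?Q) = (-1) ^ ?e * (?P * secular p k y)" by simp
  then have "(y - b m) * ((-1) ^ ?e * ?Q) = ((-1) ^ ?e * ?P) * secular p k y"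
    by (simp only: mult.assoc mult.left_commute[of "y - b m"])
  then have "y - b m < 0 \<longleftrightarrow> secular p k y < 0"
    using P Q by (metis mult_less_0_iff order_less_asym)
  then show ?thesis by simp
qed

text \<open>At 0 every branch contributes -1 to the subtracted sum, which cancels \<open>k\<close>.
  As all poles are positive, no root but the first can be 0.\<close>

lemma b_0: "b 0 = 0"
proof -
  have "secular p k 0 = 0" by (simp add: secular_def)
  moreover have "0 \<notin> set (branch_poles p k)"
  proof
    assume "0 \<in> set (branch_poles p k)"
    then obtain i where "i < 2 * k" "a i = 0" by (auto simp: in_set_conv_nth)
    then show False using a_pos[of i] by simp
  qed
  ultimately have "(\<Prod>c\<leftarrow>bs. 0 - c) = 0" by (metis mult_zero_right secular)
  then have "0 \<in> set bs" by (auto simp: prod_list_zero_iff)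
  then obtain i where i: "i < 2 * k + 1" "b i = 0" using length_bs by (auto simp: in_set_conv_nth)
  then show ?thesis using interlace(2)[of "i - 1"] a_pos[of "i - 1"] by (cases i) auto
qed

definition "energy = (\<Sum>x\<leftarrow>bs. \<bar>x - (2 - 2 / n)\<bar>) + (real (\<Sum>j<k. p j) - k) * \<bar>1 - (2 - 2 / n)\<bar>"

lemma energy_eq: "energy = 2 * ((\<Sum>i<2 * k + 1. neg i) + (real s - k) * t)"
proof -
  have d: "2 - 2 / n = d" by (simp add: d_def t_def)
  have sums: "(\<Sum>x\<leftarrow>bs. f x) = (\<Sum>i<2 * k + 1. f (b i))" for f :: "real \<Rightarrow> real"
    by (simp add: sum_list_sum_nth length_bs atLeast0LessThan)
  have "(\<Sum>x\<leftarrow>bs. \<bar>x - d\<bar>) = (\<Sum>i<2 * k + 1. 2 * neg i + b i - d)"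
    unfolding sums by (intro sum.cong) (auto simp: neg_def max_def abs_if)
  also have "\<dots> = 2 * (\<Sum>i<2 * k + 1. neg i) + (3 * real k + s) - (2 * real k + 1) * d"
    using sums[of "\<lambda>x. x"] sum_bs by (simp add: sum.distrib sum_subtractf sum_distrib_left s_def)
  also have "\<bar>1 - d\<bar> = t" using t_bounds by (simp add: d_def)
  \<comment> \<open>The trace identity: the deviations of the roots in \<open>bs\<close> sum to
    \<open>(s - k) * t\<close>, which balances the additional multiplicity \<open>s - k\<close> of
    the eigenvalue 1.\<close>
  moreover have "(3 * real k + s) - (2 * real k + 1) * d = (real s - k) * t"
  proof -
    have "(1 + real k + real s) * t = real k + real s - 1" using t_bounds(3) n_real(1) by simp
    then show ?thesis by (simp add: d_def algebra_simps)
  qed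
  ultimately show ?thesis unfolding energy_def d by (simp add: s_def algebra_simps)
qed

lemma neg_nonneg: "0 \<le> neg i" and neg_ge: "d - b i \<le> neg i"
  by (simp_all add: neg_def)

lemma neg_0: "neg 0 = d"
  using b_0 d_bounds by (simp add: neg_def)

lemma neg_Suc_le: "i < 2 * k \<Longrightarrow> a i \<le> d \<Longrightarrow> neg (Suc i) \<le> d - a i"
  using interlace(2)[of i] by (simp add: neg_def)

lemma neg_Suc_eq_0: "i < 2 * k \<Longrightarrow> k + z \<le> i \<Longrightarrow> neg (Suc i) = 0"
  using interlace(2)[of i] a_high[of i] d_bounds by (simp add: neg_def)

lemma sum_neg_le:
  assumes "m \<le> 2 * k" "\<And>i. m \<le> i \<Longrightarrow> i < 2 * k \<Longrightarrow> neg (Suc i) = 0"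
  shows "(\<Sum>i<2 * k + 1. neg i) = d + (\<Sum>i<m. neg (Suc i))"
proof -
  have "(\<Sum>i<2 * k + 1. neg i) = neg 0 + (\<Sum>i<2 * k. neg (Suc i))"
    by (simp only: Suc_eq_plus1[symmetric] sum.lessThan_Suc_shift)
  also have "(\<Sum>i<2 * k. neg (Suc i)) = (\<Sum>i<m. neg (Suc i))"
    using assms by (intro sum.mono_neutral_right) auto
  finally show ?thesis by (simp add: neg_0)
qed

text \<open>The right-hand side of \<open>1 / x \<ge> 2 * c - c\<^sup>2 * x\<close> is the tangent of \<open>1 / x\<close> at \<open>1 / c\<close>.\<close>

lemma sum_alpha_ge:
  assumes "m \<le> k"
  shows "2 * c * real m - c\<^sup>2 * ((\<Sum>j<m. real (p j)) + 2 * real m) \<le> (\<Sum>j<m. alpha (p j))"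
proof -
  have "2 * c - c\<^sup>2 * (real q + 2) \<le> alpha q" for q
  proof -
    have "0 \<le> (1 - c * (real q + 2))\<^sup>2 / (real q + 2)" by simp
    also have "\<dots> = 1 / (real q + 2) - (2 * c - c\<^sup>2 * (real q + 2))"
      by (simp add: field_simps power2_eq_square)
    finally show ?thesis using alpha_ge[of q] by simp
  qed
  then have "(\<Sum>j<m. 2 * c - c\<^sup>2 * (real (p j) + 2)) \<le> (\<Sum>j<m. alpha (p j))"
    by (intro sum_mono)
  also have "(\<Sum>j<m. 2 * c - c\<^sup>2 * (real (p j) + 2))
      = 2 * c * m - c\<^sup>2 * (\<Sum>j<m. real (p j) + 2)"
    by (simp add: sum_subtractf sum_distrib_left)
  finally show ?thesis by (simp add: sum.distrib mult.commute)
qed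

text \<open>The choice \<open>c = m / S\<close> makes the tangent touch at the mean
  \<open>S / m\<close> of the denominators; the result is Cauchy-Schwarz for the
  reciprocals.\<close>

lemma sum_alpha_ge_square:
  assumes "m \<le> k" "0 < S" "(\<Sum>j<m. real (p j)) + 2 * real m \<le> S"
  shows "(real m)\<^sup>2 / S \<le> (\<Sum>j<m. alpha (p j))"
proof -
  have "(m / S)\<^sup>2 * ((\<Sum>j<m. real (p j)) + 2 * real m) \<le> (m / S)\<^sup>2 * S"
    using assms(3) by (intro mult_left_mono) auto
  also have "\<dots> = (real m)\<^sup>2 / S" using assms(2) by (simp add: power2_eq_square)
  finally have "(real m)\<^sup>2 / S
      \<le> 2 * (m / S) * real m - (m / S)\<^sup>2 * ((\<Sum>j<m. real (p j)) + 2 * real m)"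
    by (simp add: power2_eq_square)
  then show ?thesis using sum_alpha_ge[OF assms(1), of "m / S"] by linarith
qed

section \<open>Upper bound: comparison with the star\<close>

lemma energy_le_pendant:
  assumes "0 < z"
  shows "energy \<le> 2 * (n - d)"
proof -
  have kz: "k + z \<le> 2 * k" by (simp add: z_def)
  \<comment> \<open>This puts the undecided root \<open>b (k + z)\<close> above \<open>d\<close>. In
    the subtracted sum at \<open>d\<close>, a branch with leaves counts at least -1 and a leaf at
    the centre exactly \<open>1 / t\<close>, so \<open>0 < z\<close> is decisive.\<close>
  have "secular p k d < 0"
  proof -
    have q: "d\<^sup>2 - (real q + 2) * d + 1 = t\<^sup>2 - real q * (1 + t)" for q
      by (simp add: d_def power2_eq_square algebra_simps)
    have "(\<Sum>j<k. (d - 1) / (d\<^sup>2 - (real (p j) + 2) * d + 1))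
        = (\<Sum>j<r. (d - 1) / (d\<^sup>2 - (real (p j) + 2) * d + 1))
          + (\<Sum>j\<in>{r..<k}. (d - 1) / (d\<^sup>2 - (real (p j) + 2) * d + 1))"
      using r by (simp add: sum.atLeastLessThan_concat lessThan_atLeast0)
    moreover have "(\<Sum>j<r. -1) \<le> (\<Sum>j<r. (d - 1) / (d\<^sup>2 - (real (p j) + 2) * d + 1))"
    proof (rule sum_mono)
      fix j assume "j \<in> {..<r}"
      then have "1 * (1 + t) \<le> real (p j) * (1 + t)"
        using p_pos[of j] t_bounds by (intro mult_right_mono) auto
      moreover have "t\<^sup>2 \<le> 1" using t_bounds by (simp add: power_le_one)
      ultimately have "t \<le> real (p j) * (1 + t) - t\<^sup>2" by simp
      moreover have "0 < t" using t_bounds by simp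
      ultimately have "t / (real (p j) * (1 + t) - t\<^sup>2) \<le> 1" by (simp add: divide_le_eq_1)
      moreover have "t / (t\<^sup>2 - real (p j) * (1 + t)) = - (t / (real (p j) * (1 + t) - t\<^sup>2))"
        by (simp add: minus_divide_right)
      ultimately show "-1 \<le> (d - 1) / (d\<^sup>2 - (real (p j) + 2) * d + 1)"
        unfolding q by (simp add: d_def)
    qed
    moreover have "(\<Sum>j\<in>{r..<k}. (d - 1) / (d\<^sup>2 - (real (p j) + 2) * d + 1)) = z / t"
    proof -
      have "(d - 1) / (d\<^sup>2 - (real 0 + 2) * d + 1) = 1 / t"
        unfolding q using t_bounds by (simp add: d_def power2_eq_square)
      then have "(\<Sum>j\<in>{r..<k}. (d - 1) / (d\<^sup>2 - (real (p j) + 2) * d + 1)) = (\<Sum>j\<in>{r..<k}. 1 / t)"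
        using p_zero by (intro sum.cong) auto
      then show ?thesis by (simp add: z_def)
    qed
    ultimately have "secular p k d \<le> d - k + r - z / t"
      unfolding secular_def by simp
    also have "\<dots> = 1 + t - z - z / t" using n_real(4) by (simp add: d_def)
    also have "\<dots> < 0"
    proof -
      have "1 \<le> real z" using assms by simp
      moreover have "1 / t \<le> real z / t" using assms t_bounds by (simp add: divide_right_mono)
      moreover have "1 < 1 / t" using t_bounds by simp
      ultimately show ?thesis using t_bounds by linarith
    qed
    finally show ?thesis .
  qed
  then have "d < b (k + z)"
    using a_less_d d_less_a kz by (subst secular_sign) auto
  then have zero: "neg (Suc i) = 0" if "k + z - 1 \<le> i" "i < 2 * k" for i
    using that neg_Suc_eq_0[of i] assms by (cases "i = k + z - 1") (auto simp: neg_def)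
  have "(\<Sum>i<2 * k + 1. neg i) = d + (\<Sum>i<k + z - 1. neg (Suc i))"
    by (rule sum_neg_le) (use zero kz in auto)
  also have "(\<Sum>i<k + z - 1. neg (Suc i)) \<le> (\<Sum>i<k + z - 1. d - a i)"
    using a_less_d kz by (intro sum_mono neg_Suc_le) (auto intro: less_imp_le)
  also have "(\<Sum>i<k + z - 1. d - a i) = (\<Sum>i<r. d - a i) + (\<Sum>i\<in>{r..<k + z - 1}. d - a i)"
    using r assms by (simp add: sum.atLeastLessThan_concat lessThan_atLeast0)
  also have "(\<Sum>i\<in>{r..<k + z - 1}. d - a i) = (\<Sum>i\<in>{r..<k + z - 1}. t)"
    using a_middle by (intro sum.cong) (auto simp: d_def)
  also have "\<dots> = (2 * real z - 1) * t"
    using assms r by (simp add: z_def of_nat_diff)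
  also have "(\<Sum>i<r. d - a i) = r * d - (\<Sum>i<r. alpha (p i))"
    using r by (simp add: sum_subtractf a_alpha)
  finally have N: "(\<Sum>i<2 * k + 1. neg i) \<le> d + (r * d - (\<Sum>i<r. alpha (p i)) + (2 * real z - 1) * t)"
    by simp
  have "2 * real r / n \<le> (\<Sum>i<r. alpha (p i))"
  proof -
    \<comment> \<open>The sum to be bounded is \<open>n + r - 1 - z\<close>, and \<open>z\<close> is
      at least 1. The comparison \<open>2 * r / n \<le> r\<^sup>2 / S\<close> amounts to
      \<open>(r - 2) * (n - 2) \<ge> 0\<close>, where \<open>2 \<le> r\<close> enters.\<close>
    let ?S = "real n + r - 2"
    have "(\<Sum>j<r. real (p j)) = real s" by (simp flip: sum_p)
    then have "(\<Sum>j<r. real (p j)) + 2 * real r \<le> ?S"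
      using n_real(1,4) assms by simp
    then have "(real r)\<^sup>2 / ?S \<le> (\<Sum>i<r. alpha (p i))"
      using r n_real by (intro sum_alpha_ge_square) auto
    moreover have "2 * real r / n \<le> (real r)\<^sup>2 / ?S"
    proof -
      have "0 \<le> (real r - 2) * (real n - 2)" using r n_real(2) by (intro mult_nonneg_nonneg) auto
      then have "2 * ?S \<le> r * real n" by (simp add: algebra_simps)
      then have "r * (2 * ?S) \<le> r * (r * real n)" by (intro mult_left_mono) auto
      then show ?thesis using r n_real(2) by (simp add: field_simps power2_eq_square)
    qed
    ultimately show ?thesis by linarith
  qed
  moreover have "2 * real r / n = r - r * t" by (simp add: t_def algebra_simps)
  ultimately have "(\<Sum>i<2 * k + 1. neg i) + (real s - k) * t
      \<le> d + (r * d - (r - r * t) + (2 * real z - 1) * t) + (real s - k) * t"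
    using N by simp
  also have "\<dots> = n - d"
  proof -
    have "n * t = real n - 2" by (rule t_bounds)
    then have "(1 + r + z + real s) * t = (1 + r + z + real s) - 2" using n_real(1,4) by simp
    then show ?thesis using n_real(1,4) by (simp add: d_def algebra_simps)
  qed
  finally show ?thesis using energy_eq by simp
qed

text \<open>Now \<open>b k\<close> may lie below \<open>d\<close>, as it does for the path on 5
  vertices (1.38 against 1.6). Instead of excluding it, its contribution is limited by a point
  \<open>y\<close> that the secular function certifies to be below it.\<close>

lemma energy_le_no_pendant:
  assumes "z = 0"
  shows "energy \<le> 2 * (n - d)"
proof -
  have rk: "r = k" using assms r by (simp add: z_def)
  have a_less: "a i < 1" if "i < k" for i
    using a_first[of i] alpha_1(2) that rk by simp
  \<comment> \<open>The bound \<open>d - y\<close> for \<open>neg k\<close> replaces the one by the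
    pole \<open>a (k - 1)\<close>; \<open>A\<close> is what remains of the target
    \<open>n - d\<close> after cancellation.\<close>
  have main: ?thesis
    if y: "1 \<le> y" "y \<le> 6 / 5" "secular p k y < 0"
      and A: "1 + (2 * real k - 2) / n \<le> (\<Sum>i<k - 1. alpha (p i)) + y" for y
  proof -
    have "a i < y" if "i < k" for i using a_less[OF that] y by simp
    moreover have "y < a i" if "k \<le> i" "i < 2 * k" for i using a_high[of i] that assms y by simp
    ultimately have "y < b k" using secular_sign[of k y] y by simp
    then have neg_k: "neg k \<le> d - y" using y d_bounds by (simp add: neg_def)
    have "(\<Sum>i<2 * k + 1. neg i) = d + (\<Sum>i<k. neg (Suc i))"
      by (rule sum_neg_le) (use neg_Suc_eq_0 assms in auto)
    also have "(\<Sum>i<k. neg (Suc i)) = (\<Sum>i<k - 1. neg (Suc i)) + neg k"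
      using r sum.lessThan_Suc[of "\<lambda>i. neg (Suc i)" "k - 1"] by simp
    also have "(\<Sum>i<k - 1. neg (Suc i)) \<le> (\<Sum>i<k - 1. d - a i)"
      using a_less_d by (intro sum_mono neg_Suc_le) (auto intro: less_imp_le)
    also have "(\<Sum>i<k - 1. d - a i) = (real k - 1) * d - (\<Sum>i<k - 1. alpha (p i))"
      using r by (simp add: sum_subtractf a_alpha of_nat_diff)
    finally have "(\<Sum>i<2 * k + 1. neg i)
        \<le> d + ((real k - 1) * d - (\<Sum>i<k - 1. alpha (p i)) + (d - y))"
      using neg_k by simp
    moreover have "2 / n = 1 - t" by (simp add: t_def)
    then have "(2 * real k - 2) / n = (real k - 1) * (1 - t)"
    proof -
      have "(2 * real k - 2) / n = (real k - 1) * (2 / n)" by (simp add: algebra_simps)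
      then show ?thesis unfolding \<open>2 / n = 1 - t\<close> .
    qed
    ultimately have "(\<Sum>i<2 * k + 1. neg i) + (real s - k) * t
        \<le> d + ((real k - 1) * d + d - 1 - (real k - 1) * (1 - t)) + (real s - k) * t"
      using A by linarith
    also have "\<dots> = n - d"
    proof -
      have "(1 + real k + real s) * t = (1 + real k + real s) - 2"
        using n_real(1) t_bounds(3) by simp
      then show ?thesis using n_real(1) by (simp add: d_def algebra_simps)
    qed
    finally show ?thesis using energy_eq by simp
  qed
  have last: "(\<Sum>j<k - 1. real (p j)) + 1 \<le> real s"
  proof -
    have "s = (\<Sum>j<k - 1. p j) + p (k - 1)"
      using r sum.lessThan_Suc[of p "k - 1"] by (simp add: s_def)
    moreover have "1 \<le> p (k - 1)" using p_pos rk r by simp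
    ultimately show ?thesis by simp
  qed
  show ?thesis
  proof (cases "k = 2")
    case True
    show ?thesis
    \<comment> \<open>With \<open>y = 1\<close> the condition would read
      \<open>2 / n \<le> alpha (p 0)\<close>, which fails if one branch has nearly all leaves. The
      additional 1/5 makes up for it, and the secular function is still negative at 6/5.\<close>
    proof (rule main[of "6 / 5"])
      have "(\<Sum>j<k. - (1 / 4)) \<le> (\<Sum>j<k. (6 / 5 - 1) / ((6 / 5)\<^sup>2 - (real (p j) + 2) * (6 / 5) + 1))"
      proof (rule sum_mono)
        fix j assume "j \<in> {..<k}"
        then have "1 \<le> real (p j)" using p_pos[of j] rk by simp
        moreover have "(6 / 5 :: real)\<^sup>2 = 36 / 25" by (simp add: power2_eq_square)
        moreover have "(real (p j) + 2) * (6 / 5) = 6 / 5 * real (p j) + 12 / 5"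
          by (simp only: distrib_right)
        ultimately have "(6 / 5)\<^sup>2 - (real (p j) + 2) * (6 / 5) + 1 \<le> - (4 / 5)" by linarith
        moreover have "- (1 / 4) \<le> (6 / 5 - 1) / D" if "D \<le> - (4 / 5)" for D :: real
          using that by (simp add: neg_le_divide_eq)
        ultimately show "- (1 / 4 :: real) \<le> (6 / 5 - 1) / ((6 / 5)\<^sup>2 - (real (p j) + 2) * (6 / 5) + 1)"
          by blast
      qed
      then show "secular p k (6 / 5) < 0" using True by (simp add: secular_def)
      have "real (p 0) + 2 \<le> real n - 2" using last n_real(1) True by simp
      then have "1 / (real n - 2) \<le> 1 / (real (p 0) + 2)" by (intro divide_left_mono) auto
      also have "\<dots> \<le> alpha (p 0)" by (rule alpha_ge)
      finally have "1 / (real n - 2) \<le> alpha (p 0)" .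
      moreover have "2 / real n \<le> 1 / (real n - 2) + 1 / 5"
        using n_real(2) mult_nonneg_nonneg[of "real n - 2" "real n - 5"]
        by (simp add: field_simps)
      ultimately show "1 + (2 * real k - 2) / n \<le> (\<Sum>i<k - 1. alpha (p i)) + 6 / 5"
        using True by simp
    qed simp_all
  next
    case False
    then have k3: "3 \<le> k" using r by simp
    show ?thesis
    proof (rule main[of 1])
      show "secular p k 1 < 0" using r by (simp add: secular_def)
      \<comment> \<open>The last branch keeps at least one leaf, which bounds the others. The
        comparison with \<open>2 * (k - 1) / n\<close> follows from
        \<open>(k - 3) * (n - 2) \<ge> 0\<close>; this is why \<open>k = 2\<close> is
        separate.\<close>
      let ?S = "real n + k - 4"
      have "(\<Sum>j<k - 1. real (p j)) + 2 * real (k - 1) \<le> ?S"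
        using last n_real(1) r by (simp add: of_nat_diff)
      then have "(real (k - 1))\<^sup>2 / ?S \<le> (\<Sum>j<k - 1. alpha (p j))"
        using k3 n_real(2) by (intro sum_alpha_ge_square) auto
      moreover have "2 * real (k - 1) / n \<le> (real (k - 1))\<^sup>2 / ?S"
      proof -
        have "0 \<le> (real k - 3) * (real n - 2)" using k3 n_real(2) by (intro mult_nonneg_nonneg) auto
        then have "2 * ?S \<le> real (k - 1) * real n" using r by (simp add: of_nat_diff algebra_simps)
        then have "real (k - 1) * (2 * ?S) \<le> real (k - 1) * (real (k - 1) * real n)"
          by (intro mult_left_mono) auto
        then show ?thesis using r n_real(2) by (simp add: field_simps power2_eq_square)
      qed
      ultimately show "1 + (2 * real k - 2) / n \<le> (\<Sum>i<k - 1. alpha (p i)) + 1"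
        using r by (simp add: of_nat_diff algebra_simps)
    qed simp_all
  qed
qed

lemma energy_le_star: "energy \<le> laplacian_energy (star_graph n)"
proof -
  have "energy \<le> 2 * (n - d)"
    using energy_le_pendant energy_le_no_pendant by (cases "z = 0") auto
  also have "\<dots> = laplacian_energy (star_graph n)"
    using laplacian_energy_star_graph[of n] n_real(2) by (simp add: d_def t_def)
  finally show ?thesis .
qed

section \<open>Lower bound: comparison with the path\<close>

lemma energy_ge: "2 * (1 + (real r - 1) * (1 - alpha 1) + t * (real n - 1 - r)) \<le> energy"
proof -
  have "k + z \<le> 2 * k" by (simp add: z_def)
  \<comment> \<open>A root is at most the pole of the same index: \<open>alpha 1\<close> bounds
    those with \<open>1 \<le> i < r\<close>, and 1 bounds the next \<open>2 * z\<close>. Whatever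
    later roots contribute is dropped.\<close>
  have "d + (\<Sum>i\<in>{1..<r}. d - alpha 1) + (\<Sum>i\<in>{r..<k + z}. t)
      \<le> neg 0 + (\<Sum>i\<in>{1..<r}. neg i) + (\<Sum>i\<in>{r..<k + z}. neg i)"
  proof (intro add_mono sum_mono)
    show "d \<le> neg 0" by (simp add: neg_0)
    show "d - alpha 1 \<le> neg i" if "i \<in> {1..<r}" for i
      using that neg_ge[of i] interlace(1)[of i] a_first[of i] r by simp
    show "t \<le> neg i" if "i \<in> {r..<k + z}" for i
      using that neg_ge[of i] interlace(1)[of i] a_middle[of i] \<open>k + z \<le> 2 * k\<close> by (simp add: d_def)
  qed
  also have "\<dots> = (\<Sum>i\<in>insert 0 ({1..<r} \<union> {r..<k + z}). neg i)"
    by (subst sum.insert) (use r in \<open>auto simp: sum.union_disjoint\<close>)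
  also have "\<dots> \<le> (\<Sum>i<2 * k + 1. neg i)"
    using neg_nonneg \<open>k + z \<le> 2 * k\<close> r by (intro sum_mono2) auto
  finally have "d + (real r - 1) * (d - alpha 1) + 2 * real z * t \<le> (\<Sum>i<2 * k + 1. neg i)"
    using r by (simp add: z_def of_nat_diff)
  moreover have "d + (real r - 1) * (d - alpha 1) + 2 * real z * t + (real s - k) * t
      = 1 + (real r - 1) * (1 - alpha 1) + t * (real n - 1 - r)"
    using n_real(1,4) by (simp add: d_def algebra_simps)
  ultimately show ?thesis using energy_eq by simp
qed

text \<open>The bound of \<open>energy_ge\<close> is affine in \<open>r\<close> with slope
  \<open>(1 - alpha 1) - t \<le> 0\<close>, so the largest possible value \<open>(n - 1) / 2\<close>
  is the worst one. The rest is a numerical comparison with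
  \<open>1 / sin (pi / (2 * n)) \<le> 0.644 * n\<close>.\<close>

lemma energy_ge_path_large:
  assumes "7 \<le> n"
  shows "laplacian_energy (path_graph n) \<le> energy"
proof -
  let ?N = "real n" and ?f = "pi / (2 * real n)"
  have N: "7 \<le> ?N" using assms by simp
  have "1 / (0.644 * ?N) \<le> sin ?f" using sin_pi_over_ge(2)[OF n_real(2) assms] .
  moreover have "0 < 1 / (0.644 * ?N)" using N by simp
  ultimately have "0 < sin ?f" by linarith
  then have inv: "1 / sin ?f \<le> 161 / 250 * ?N"
    using \<open>1 / (0.644 * ?N) \<le> sin ?f\<close> N by (simp add: field_simps)
  have g: "309 / 500 \<le> 1 - alpha 1" using alpha_1(2) by simp
  have "1 - alpha 1 \<le> t"
  proof -
    have "2.23 \<le> sqrt 5" "sqrt 5 \<le> 2.25"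
      by (rule real_le_rsqrt, simp add: power2_eq_square) (rule real_le_lsqrt, simp_all add: power2_eq_square)
    moreover have "2 / ?N \<le> 2 / 7" using N by (intro divide_left_mono) auto
    ultimately show ?thesis unfolding alpha_1 t_def by (simp add: field_simps)
  qed
  have "1 + ((?N - 3) / 2) * (309 / 500) + t * ((?N - 1) / 2)
      \<le> 1 + ((?N - 3) / 2) * (1 - alpha 1) + t * ((?N - 1) / 2)"
    using g N t_bounds by (intro add_mono mult_left_mono) auto
  also have "\<dots> = 1 + (real r - 1) * (1 - alpha 1) + t * (?N - 1 - r)
      + ((?N - 1) / 2 - r) * ((1 - alpha 1) - t)"
    by (simp add: algebra_simps add_divide_distrib diff_divide_distrib)
  also have "((?N - 1) / 2 - r) * ((1 - alpha 1) - t) \<le> 0"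
    using n_real(3) \<open>1 - alpha 1 \<le> t\<close> by (intro mult_nonneg_nonpos) auto
  also have "1 + (real r - 1) * (1 - alpha 1) + t * (?N - 1 - r) \<le> energy / 2"
    using energy_ge by simp
  finally have E: "1 + ((?N - 3) / 2) * (309 / 500) + t * ((?N - 1) / 2) \<le> energy / 2" by simp
  have tN: "t * ((?N - 1) / 2) = ?N / 2 - 3 / 2 + 1 / ?N"
    using N by (simp add: t_def field_simps)
  show ?thesis
  proof (cases "even n")
    case True
    then have "n \<noteq> 7" by auto
    then have N8: "8 \<le> ?N" using assms by simp
    have "laplacian_energy (path_graph n) / 2 = cos ?f / sin ?f"
      using laplacian_energy_path_graph(2)[OF n_real(2) True] by simp
    also have "\<dots> \<le> 1 / sin ?f" using \<open>0 < sin ?f\<close> by (intro divide_right_mono) auto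
    also have "\<dots> \<le> 161 / 250 * ?N" by (rule inv)
    also have "\<dots> \<le> 1 + ((?N - 3) / 2) * (309 / 500) + t * ((?N - 1) / 2)"
    proof -
      \<comment> \<open>Clearing the denominator gives a quadratic inequality in \<open>?N\<close>;
        \<open>?N * ?N\<close> is bounded by its tangent at the smallest admissible value, here 8
        and in the odd case 7.\<close>
      have "0 \<le> (?N - 8) * (?N - 8)" by simp
      then have "1427 / 1000 * ?N \<le> 33 / 200 * (?N * ?N) + 1" using N8 by (simp add: algebra_simps)
      then have "1427 / 1000 \<le> 33 / 200 * ?N + 1 / ?N" using N8 by (simp add: field_simps)
      then show ?thesis unfolding tN
        by (simp add: diff_divide_distrib left_diff_distrib)
    qed
    finally show ?thesis using E by linarith
  next
    case False
    have "laplacian_energy (path_graph n) / 2 = 1 / sin ?f - 1 / ?N"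
      using laplacian_energy_path_graph(1)[OF n_real(2) False] by (simp add: diff_divide_distrib)
    also have "\<dots> \<le> 161 / 250 * ?N - 1 / ?N" using inv by simp
    also have "\<dots> \<le> 1 + ((?N - 3) / 2) * (309 / 500) + t * ((?N - 1) / 2)"
    proof -
      have "0 \<le> (?N - 7) * (?N - 7)" by simp
      then have "1427 / 1000 * ?N \<le> 33 / 200 * (?N * ?N) + 2" using N by (simp add: algebra_simps)
      then have "1427 / 1000 \<le> 33 / 200 * ?N + 2 / ?N" using N by (simp add: field_simps)
      then show ?thesis unfolding tN
        by (simp add: diff_divide_distrib left_diff_distrib)
    qed
    finally show ?thesis using E by linarith
  qed
qed

text \<open>The terms \<open>d - b i\<close> may be negative; every choice of \<open>m\<close> gives
  a valid bound, and \<open>m\<close> is the number of roots worth counting.\<close>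

lemma energy_ge_prefix:
  assumes "m \<le> 2 * k + 1"
  shows "2 * ((\<Sum>i<m. d - b i) + (real s - k) * t) \<le> energy"
proof -
  have "(\<Sum>i<m. d - b i) \<le> (\<Sum>i<m. neg i)" by (intro sum_mono neg_ge)
  also have "\<dots> \<le> (\<Sum>i<2 * k + 1. neg i)"
    using assms neg_nonneg by (intro sum_mono2) auto
  finally show ?thesis using energy_eq by simp
qed

lemma b_le_of_secular:
  assumes "m \<le> 2 * k" "\<And>i. i < m \<Longrightarrow> a i < y" "\<And>i. m \<le> i \<Longrightarrow> i < 2 * k \<Longrightarrow> y < a i"
    and "0 \<le> secular p k y"
  shows "b m \<le> y"
  using secular_sign[OF assms(1-3)] assms(4) by linarith

lemma b_1_le: "b 1 \<le> alpha 1"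
  using interlace(1)[of 1] a_first[of 1] r by simp

text \<open>The data are those of the path itself, so there is no slack: \<open>y\<close> is its
  third eigenvalue \<open>2 - 2 * cos (2 * pi / 5)\<close>, and the bound from the three smallest
  roots equals the path energy.\<close>

lemma energy_ge_path_5:
  assumes n5: "n = 5"
  shows "laplacian_energy (path_graph n) \<le> energy"
proof -
  have "k = 2" "r = 2" "s = 2" using n_real(1) r r_le_s n5 by linarith+
  note kr = this
  have "z = 0" "t = 3 / 5" "d = 8 / 5" unfolding z_def d_def t_def using kr n5 by simp_all
  have "1 \<le> p 0" "1 \<le> p 1" "p 0 + p 1 = 2"
    using p_pos kr sum_p by (auto simp: numeral_2_eq_2)
  then have p: "p 0 = 1" "p 1 = 1" by simp_all
  define y where "y = (5 - sqrt 5) / 2"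
  have sqrt: "2.2 \<le> sqrt 5" "sqrt 5 \<le> 2.3"
    by (rule real_le_rsqrt, simp add: power2_eq_square) (rule real_le_lsqrt, simp_all add: power2_eq_square)
  then have y: "1 < y" "y < 2" by (simp_all add: y_def)
  have yy: "y * y = 5 * y - 5"
  proof -
    have "sqrt 5 = 5 - 2 * y" unfolding y_def by (simp add: diff_divide_distrib)
    then have "(5 - 2 * y) * (5 - 2 * y) = 5" by (metis abs_numeral real_sqrt_mult_self)
    then show ?thesis by (simp add: algebra_simps)
  qed
  have "secular p k y = 0"
  proof -
    have "y\<^sup>2 - (real 1 + 2) * y + 1 = 2 * (y - 2)" using yy by (simp add: power2_eq_square)
    then have "secular p k y = y - 2 - 2 * ((y - 1) / (2 * (y - 2)))"
      using kr p by (simp add: secular_def numeral_2_eq_2)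
    also have "\<dots> = ((y - 2) * (y - 2) - (y - 1)) / (y - 2)" using y by (simp add: field_simps)
    also have "(y - 2) * (y - 2) - (y - 1) = 0" using yy by (simp add: algebra_simps)
    finally show ?thesis by simp
  qed
  then have "b 2 \<le> y"
    using a_low a_high y kr \<open>z = 0\<close> by (intro b_le_of_secular) force+
  then have "2 * (3 * d - alpha 1 - y) \<le> energy"
    using energy_ge_prefix[of 3] b_0 b_1_le kr by (simp add: numeral_3_eq_3 numeral_2_eq_2)
  moreover have "2 * (3 * d - alpha 1 - y) = 2 / sin (pi / 10) - 2 / 5"
  proof -
    have "(sqrt 5 - 1) * (sqrt 5 + 1) = 4" by (simp add: algebra_simps)
    then have "2 / sin (pi / 10) = 2 * (sqrt 5 + 1)"
      using sqrt unfolding sin_pi_10 by (simp add: field_simps)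
    moreover have A: "alpha 1 = 3 / 2 - sqrt 5 / 2" and Y: "y = 5 / 2 - sqrt 5 / 2"
      unfolding alpha_1(1) y_def by (simp_all add: diff_divide_distrib)
    have "2 * (3 * d - alpha 1 - y) = 2 * (sqrt 5 + 1) - 2 / 5"
      unfolding A Y \<open>d = 8 / 5\<close> by (simp add: algebra_simps)
    ultimately show ?thesis by simp
  qed
  ultimately show ?thesis using laplacian_energy_path_graph(1)[of 5] n5 by simp
qed

text \<open>Two trees remain, with \<open>k = 2\<close> and \<open>k = 3\<close>. The points 31/20
  and 22/25 are just below the largest values of \<open>b 2\<close> that the estimate tolerates
  against \<open>2 + sqrt 3 \<le> 3.7325\<close>.\<close>

lemma energy_ge_path_6:
  assumes n6: "n = 6"
  shows "laplacian_energy (path_graph n) \<le> energy"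
proof -
  have "laplacian_energy (path_graph n) = 2 * (cos (pi / 12) / sin (pi / 12))"
    using laplacian_energy_path_graph(2)[of 6] n6 by simp
  also have "\<dots> = 2 * (2 + sqrt 3)" unfolding cot_pi_12 ..
  also have "sqrt 3 \<le> 1.7325" by (rule real_le_lsqrt) (simp_all add: power2_eq_square)
  finally have path: "laplacian_energy (path_graph n) \<le> 2 * 3.7325" by simp
  have td: "t = 2 / 3" "d = 5 / 3" unfolding d_def t_def using n6 by simp_all
  have "r = 2" using n_real(3) r n6 by simp
  have ks: "k + s = 5" using n_real(1) n6 by linarith
  then have "k = 2 \<or> k = 3" using r r_le_s by linarith
  have p01: "1 \<le> p 0" "1 \<le> p 1" "p 0 + p 1 = s"
    using p_pos \<open>r = 2\<close> sum_p by (auto simp: numeral_2_eq_2)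
  show ?thesis
  proof (cases "k = 2")
    case True
    then have z: "z = 0" "s = 3" unfolding z_def using \<open>r = 2\<close> ks by simp_all
    then consider "p 0 = 1" "p 1 = 2" | "p 0 = 2" "p 1 = 1" using p01 by linarith
    then have "0 \<le> secular p k (31 / 20)"
      using True by cases (simp_all add: secular_def numeral_2_eq_2 power2_eq_square)
    then have "b 2 \<le> 31 / 20"
      using a_low a_high True z by (intro b_le_of_secular) force+
    then have "2 * (3 * d - alpha 1 - 31 / 20 + t) \<le> energy"
      using energy_ge_prefix[of 3] b_0 b_1_le True z by (simp add: numeral_3_eq_3 numeral_2_eq_2)
    then show ?thesis using path alpha_1(2) td by simp
  next
    case False
    then have k: "k = 3" using \<open>k = 2 \<or> k = 3\<close> by simp
    then have z: "z = 1" "s = 2" unfolding z_def using \<open>r = 2\<close> ks by simp_all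
    then have p: "p 0 = 1" "p 1 = 1" "p 2 = 0" using p01 p_zero[of 2] \<open>r = 2\<close> k by simp_all
    have "0 \<le> secular p k (22 / 25)"
      using p k by (simp add: secular_def numeral_3_eq_3 numeral_2_eq_2 power2_eq_square)
    then have "b 2 \<le> 22 / 25"
    proof (rule b_le_of_secular[rotated -1])
      show "a i < 22 / 25" if "i < 2" for i
        using a_first[of i] alpha_1(2) that \<open>r = 2\<close> by simp
      show "22 / 25 < a i" if "2 \<le> i" "i < 2 * k" for i
        using a_middle[of i] a_high[of i] that \<open>r = 2\<close> by (cases "i < k + z") simp_all
    qed (use k in simp)
    moreover have "b 3 \<le> 1" using interlace(1)[of 3] a_middle[of 3] k z \<open>r = 2\<close> by simp
    ultimately have "2 * (4 * d - alpha 1 - 22 / 25 - 1 - t) \<le> energy"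
      using energy_ge_prefix[of 4] b_0 b_1_le k z
      by (simp add: eval_nat_numeral)
    then show ?thesis using path alpha_1(2) td by simp
  qed
qed

lemma energy_ge_path: "laplacian_energy (path_graph n) \<le> energy"
proof -
  consider "n = 5" | "n = 6" | "7 \<le> n" using n_real(2) by linarith
  then show ?thesis
    by cases (use energy_ge_path_5 energy_ge_path_6 energy_ge_path_large in auto)
qed

end

section \<open>Walks without backtracking\<close>

lemma successively_nthD:
  "successively P xs \<Longrightarrow> Suc i < length xs \<Longrightarrow> P (xs ! i) (xs ! Suc i)"
proof (induction xs arbitrary: i)
  case (Cons x xs)
  then show ?case by (cases i; cases xs) (auto simp: successively_Cons)
qed simp

definition edge_walk :: "('a \<times> 'a) set \<Rightarrow> 'a list \<Rightarrow> bool" where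
  "edge_walk E p \<longleftrightarrow> p \<noteq> [] \<and> successively (\<lambda>x y. (x, y) \<in> E) p"

text \<open>Only immediate returns are forbidden: a local condition that is easily checked on
  explicit lists, from which distinctness follows in a tree.\<close>

definition nb_walk :: "('a \<times> 'a) set \<Rightarrow> 'a list \<Rightarrow> bool" where
  "nb_walk E p \<longleftrightarrow> edge_walk E p \<and> (\<forall>i. i + 2 < length p \<longrightarrow> p ! i \<noteq> p ! (i + 2))"

lemma edge_walk_simps [simp]:
  "edge_walk E [x]"
  "edge_walk E (x # y # p) \<longleftrightarrow> (x, y) \<in> E \<and> edge_walk E (y # p)"
  by (auto simp: edge_walk_def)

lemma nb_walk_simps [simp]:
  "nb_walk E [x]"
  "nb_walk E [x, y] \<longleftrightarrow> (x, y) \<in> E"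
  "nb_walk E (x # y # z # p) \<longleftrightarrow> (x, y) \<in> E \<and> x \<noteq> z \<and> nb_walk E (y # z # p)"
proof -
  show "nb_walk E (x # y # z # p) \<longleftrightarrow> (x, y) \<in> E \<and> x \<noteq> z \<and> nb_walk E (y # z # p)"
  proof
    assume *: "nb_walk E (x # y # z # p)"
    then have "(y # z # p) ! i \<noteq> (y # z # p) ! (i + 2)" if "i + 2 < length (y # z # p)" for i
      using that unfolding nb_walk_def by (metis add_Suc length_Cons nth_Cons_Suc Suc_less_eq)
    moreover have "x \<noteq> z" using * unfolding nb_walk_def by (auto dest: spec[of _ 0])
    ultimately show "(x, y) \<in> E \<and> x \<noteq> z \<and> nb_walk E (y # z # p)"
      using * by (auto simp: nb_walk_def)
  next
    assume *: "(x, y) \<in> E \<and> x \<noteq> z \<and> nb_walk E (y # z # p)"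
    have "(x # y # z # p) ! i \<noteq> (x # y # z # p) ! (i + 2)" if "i + 2 < length (x # y # z # p)" for i
      using * that unfolding nb_walk_def by (cases i) auto
    then show "nb_walk E (x # y # z # p)" using * by (auto simp: nb_walk_def)
  qed
qed (auto simp: nb_walk_def)

lemma nb_walk_ConsD: "nb_walk E (x # y # p) \<Longrightarrow> nb_walk E (y # p)"
  by (cases p) auto

text \<open>A repeated vertex of a walk without backtracking yields, between two occurrences at
  minimal distance, a cycle.\<close>

lemma nb_walk_distinct:
  assumes irrefl: "\<And>x. (x, x) \<notin> E"
    and acyclic: "\<And>q. edge_walk E q \<Longrightarrow> distinct q \<Longrightarrow> 3 \<le> length q \<Longrightarrow> (last q, hd q) \<notin> E"
    and p: "nb_walk E p"
  shows "distinct p"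
proof (rule ccontr)
  assume "\<not> distinct p"
  define rep where "rep d \<longleftrightarrow> 0 < d \<and> (\<exists>i. i + d < length p \<and> p ! i = p ! (i + d))" for d
  obtain i j where "i < j" "j < length p" "p ! i = p ! j"
    using \<open>\<not> distinct p\<close> by (auto simp: distinct_conv_nth) (metis linorder_neqE_nat)
  then have "rep (j - i)" unfolding rep_def by (auto intro!: exI[of _ i])
  define d where "d = (LEAST d. rep d)"
  have "rep d" unfolding d_def by (rule LeastI) fact
  then obtain i where d: "0 < d" and i: "i + d < length p" "p ! i = p ! (i + d)"
    unfolding rep_def by blast
  have least: "d \<le> e" if "rep e" for e unfolding d_def using that by (rule Least_le)
  have succ: "successively (\<lambda>x y. (x, y) \<in> E) p" using p by (simp add: nb_walk_def edge_walk_def)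
  let ?q = "take d (drop i p)"
  have len: "length ?q = d" using i by simp
  have nth: "?q ! j = p ! (i + j)" if "j < d" for j using that i by simp
  have "p = take i p @ ?q @ drop d (drop i p)" by (metis append_take_drop_id)
  then have "successively (\<lambda>x y. (x, y) \<in> E) ?q"
    using succ by (metis successively_append_iff)
  moreover have "?q \<noteq> []" using len d by auto
  ultimately have walk: "edge_walk E ?q" by (simp add: edge_walk_def)
  have "distinct ?q"
  proof (rule ccontr)
    assume "\<not> distinct ?q"
    then obtain a b where "a < b" "b < d" "?q ! a = ?q ! b"
      using len by (auto simp: distinct_conv_nth simp del: nth_take nth_drop) (metis linorder_neqE_nat)
    then have "rep (b - a)" unfolding rep_def using nth i by (auto intro!: exI[of _ "i + a"])
    then show False using least[of "b - a"] \<open>a < b\<close> \<open>b < d\<close> by simp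
  qed
  moreover have "3 \<le> length ?q"
  proof -
    have "d \<noteq> 1" using successively_nthD[OF succ, of i] i irrefl by auto
    moreover have "d \<noteq> 2" using p i by (auto simp: nb_walk_def)
    ultimately show ?thesis using d unfolding len by simp
  qed
  moreover have "(last ?q, hd ?q) \<in> E"
  proof -
    have "last ?q = p ! (i + (d - 1))" using \<open>?q \<noteq> []\<close> len d nth[of "d - 1"] by (simp add: last_conv_nth)
    moreover have "hd ?q = p ! Suc (i + (d - 1))"
      using \<open>?q \<noteq> []\<close> nth[of 0] d i by (simp add: hd_conv_nth)
    ultimately show ?thesis using successively_nthD[OF succ, of "i + (d - 1)"] i d by simp
  qed
  ultimately show False using acyclic[OF walk] by blast
qed

text \<open>Where two walks from the same vertex part, reversing the first and appending the second gives a
  walk without backtracking.\<close>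

lemma nb_walk_unique:
  assumes sym: "\<And>x y. (x, y) \<in> E \<Longrightarrow> (y, x) \<in> E"
    and dist: "\<And>p. nb_walk E p \<Longrightarrow> distinct p"
    and "nb_walk E p" "nb_walk E q" "hd p = hd q" "last p = last q"
  shows "p = q"
  using assms(3-)
proof (induction p arbitrary: q)
  case Nil
  then show ?case by (simp add: nb_walk_def edge_walk_def)
next
  case (Cons x p)
  obtain q' where q: "q = x # q'" using Cons.prems by (cases q) (auto simp: nb_walk_def edge_walk_def)
  have "x \<notin> set p" "x \<notin> set q'" using dist[OF Cons.prems(1)] dist[OF Cons.prems(2)] q by auto
  show ?case
  proof (cases "p = [] \<or> q' = []")
    \<comment> \<open>If one walk is just \<open>[x]\<close>, the other also ends in
      \<open>x\<close>; as \<open>x\<close> does not recur in it, it is \<open>[x]\<close>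
      too.\<close>
    case True
    then show ?thesis
      using Cons.prems(4) q \<open>x \<notin> set p\<close> \<open>x \<notin> set q'\<close> last_in_set[of p] last_in_set[of q']
      by (auto split: if_splits)
  next
    case False
    then obtain v p' w q'' where p': "p = v # p'" and q': "q' = w # q''"
      by (meson neq_Nil_conv)
    have walks: "nb_walk E p" "nb_walk E q'"
      using Cons.prems(1,2) unfolding q p' q' by (auto dest: nb_walk_ConsD)
    have "last p = last q'" using Cons.prems(4) q p' q' by simp
    show ?thesis
    proof (cases "v = w")
      case True
      then show ?thesis using Cons.IH[OF walks(1,2)] p' q' q \<open>last p = last q'\<close> by simp
    next
      case neq: False
      let ?r = "rev (x # p) @ q'" and ?m = "length (x # p)"
      have "edge_walk E ?r"
        using Cons.prems(1,2) sym unfolding nb_walk_def edge_walk_def q p' q'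
        by (auto simp: successively_append_iff successively_Cons last_rev hd_rev elim!: successively_mono)
      moreover have "?r ! i \<noteq> ?r ! (i + 2)" if "i + 2 < length ?r" for i
      proof -
        have P: "(x # p) ! j \<noteq> (x # p) ! (j + 2)" if "j + 2 < ?m" for j
          using Cons.prems(1) that unfolding nb_walk_def by blast
        have Q: "q ! j \<noteq> q ! (j + 2)" if "j + 2 < length q" for j
          using Cons.prems(2) that unfolding nb_walk_def by blast
        have L: "?r ! j = (x # p) ! (?m - Suc j)" if "j < ?m" for j
          using that by (simp only: nth_append length_rev if_True rev_nth)
        have R: "?r ! j = q ! Suc (j - ?m)" if "?m \<le> j" for j
          using that by (subst nth_append) (simp add: q)
        \<comment> \<open>The positions \<open>i\<close> and \<open>i + 2\<close> lie both in the
          reversed walk, on either side of \<open>x\<close> (where \<open>v \<noteq> w\<close> is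
          used), at \<open>x\<close> and two steps along \<open>q\<close>, or both in
          \<open>q'\<close>.\<close>
        consider "i + 2 < ?m" | "i + 2 = ?m" | "i + 1 = ?m" | "?m \<le> i" by linarith
        then show ?thesis
        proof cases
          case 1
          define j where "j = ?m - Suc (i + 2)"
          have j: "?m - Suc i = j + 2" "j + 2 < ?m" using 1 by (simp_all add: j_def)
          have "?r ! i = (x # p) ! (j + 2)" using L[of i] 1 unfolding j(1) by linarith
          moreover have "?r ! (i + 2) = (x # p) ! j" using L[of "i + 2"] 1 unfolding j_def by blast
          ultimately show ?thesis using P[OF j(2)] by metis
        next
          case 2
          then have "?m - Suc i = 1" by simp
          then show ?thesis using L[of i] R[of "i + 2"] 2 neq p' q q' by simp
        next
          case 3
          then have "?m - Suc i = 0" "Suc (i + 2 - ?m) = 2" by simp_all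
          then show ?thesis using L[of i] R[of "i + 2"] Q[of 0] that 3 q q' by simp
        next
          case 4
          then have "Suc (i + 2 - ?m) = Suc (i - ?m) + 2" by simp
          then show ?thesis using R[of i] R[of "i + 2"] Q[of "Suc (i - ?m)"] that 4 q by simp
        qed
      qed
      ultimately have "distinct ?r" by (intro dist) (simp add: nb_walk_def)
      moreover have "last p \<in> set p" "last p \<in> set q'"
        using False last_in_set[of p] last_in_set[of q'] \<open>last p = last q'\<close> by metis+
      ultimately show ?thesis by auto
    qed
  qed
qed

text \<open>Cutting out a step together with its immediate reversal keeps both ends and shortens the
  walk.\<close>

lemma edge_walk_imp_nb_walk:
  assumes "edge_walk E p"
  shows "\<exists>q. nb_walk E q \<and> hd q = hd p \<and> last q = last p \<and> length q \<le> length p"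
  using assms
proof (induction "length p" arbitrary: p rule: less_induct)
  case less
  show ?case
  proof (cases "nb_walk E p")
    case False
    then obtain i where i: "i + 2 < length p" "p ! i = p ! (i + 2)"
      using less.prems by (auto simp: nb_walk_def)
    let ?q = "take i p @ drop (i + 2) p"
    have d: "drop i p = p ! i # p ! Suc i # p ! (i + 2) # drop (i + 3) p"
      "drop (i + 2) p = p ! i # drop (i + 3) p"
      using i by (simp_all add: Cons_nth_drop_Suc[symmetric] eval_nat_numeral)
    have p: "p = take i p @ p ! i # p ! Suc i # p ! (i + 2) # drop (i + 3) p"
      using d(1) by (metis append_take_drop_id)
    then have "successively (\<lambda>x y. (x, y) \<in> E) (take i p @ p ! i # p ! Suc i # p ! (i + 2) # drop (i + 3) p)"
      using less.prems by (simp add: edge_walk_def)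
    then have "edge_walk E ?q"
      unfolding edge_walk_def d(2) i(2)[symmetric]
      by (auto simp: successively_append_iff successively_Cons)
    moreover have "hd ?q = hd p"
      using i less.prems
      by (cases "i = 0") (auto simp: hd_append hd_drop_conv_nth hd_conv_nth edge_walk_def)
    moreover have "last ?q = last p" using i by simp
    moreover have "length ?q < length p" using i by simp
    ultimately show ?thesis using less.hyps[of ?q] by force
  qed auto
qed

lemma successively_iff_vwalk_arcs:
  "successively (\<lambda>x y. (x, y) \<in> E) p \<longleftrightarrow> set (vwalk_arcs p) \<subseteq> E"
  by (induction p rule: vwalk_arcs.induct) auto

context pair_graph
begin

lemma awalk_vwalk_arcs:
  "edge_walk (parcs G) p \<Longrightarrow> hd p \<in> pverts G \<Longrightarrow> awalk (hd p) (vwalk_arcs p) (last p)"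
proof (induction p rule: vwalk_arcs.induct)
  case (3 x y xs)
  then have "awalk y (vwalk_arcs (y # xs)) (last (y # xs))" by (auto dest: in_arcsD2)
  then show ?case using 3 by (simp add: awalk_Cons_iff)
qed (auto simp: edge_walk_def awalk_Nil_iff)

lemma awalk_cost_1: "awalk_cost (\<lambda>_. 1) p = length p"
  by (induction p) auto

lemma graph_dist_le:
  assumes "edge_walk (parcs G) p" "hd p \<in> pverts G" "length p \<le> Suc m"
  shows "graph_dist G (hd p) (last p) \<le> ereal m"
proof -
  have "graph_dist G (hd p) (last p) \<le> awalk_cost (\<lambda>_. 1) (vwalk_arcs p)"
    unfolding graph_dist_def using awalk_vwalk_arcs[OF assms(1,2)] by (rule min_cost_le_walk_cost)
  also have "\<dots> \<le> ereal m"
  proof -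
    have "length (vwalk_arcs p) = length p - 1"
      using vwalk_length_simp[of p] unfolding vwalk_length_def .
    then show ?thesis using assms(3) by (simp add: awalk_cost_1)
  qed
  finally show ?thesis .
qed

text \<open>The distance is an infimum, so a strict bound yields a walk below it; its integral
  length is then at most \<open>m\<close>, that is, it has at most \<open>m + 1\<close>
  vertices.\<close>

lemma graph_dist_lessD:
  assumes "graph_dist G u v < ereal (Suc m)"
  obtains p where "nb_walk (parcs G) p" "hd p = u" "last p = v" "length p \<le> Suc m"
proof -
  obtain es where es: "awalk u es v" "ereal (awalk_cost (\<lambda>_. 1) es) < ereal (Suc m)"
    using assms unfolding graph_dist_def \<mu>_def by (auto simp: INF_less_iff)
  have "length es \<le> m" using es(2) by (simp add: awalk_cost_1)
  let ?p = "pawalk_verts u es"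
  have "vwalk ?p (with_proj G)" using awalk_imp_vwalk[OF es(1)] by simp
  then have "edge_walk (parcs G) ?p"
    by (auto simp: vwalk_def edge_walk_def successively_iff_vwalk_arcs)
  moreover have "hd ?p = u" "last ?p = v" using es(1) by auto
  moreover have "length ?p \<le> Suc m"
    using \<open>length es \<le> m\<close> length_awalk_verts[of u es] by simp
  ultimately show thesis using edge_walk_imp_nb_walk[of "parcs G" ?p] that by force
qed

end

text \<open>Walks without backtracking are determined by their ends, hence are shortest and have at
  most 5 vertices. The centre is the middle of a path \<open>u, a, c, b, v\<close> realising the
  diameter. A walk \<open>c, y, z, x\<close> to a vertex outside the claimed range could be
  prolonged backwards through \<open>a\<close> or through \<open>b\<close>, whichever differs from
  \<open>y\<close>, to 6 vertices.\<close>

lemma diameter_4_center: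
  assumes tree: "undirected_tree T" and diam: "diameter T = 4"
  obtains c a u b v where
    "nb_walk (parcs T) [u, a, c, b, v]"
    "\<And>x. x \<in> pverts T \<Longrightarrow> x = c \<or> (c, x) \<in> parcs T \<or> (\<exists>y. (c, y) \<in> parcs T \<and> (y, x) \<in> parcs T)"
    "\<And>p. nb_walk (parcs T) p \<Longrightarrow> distinct p"
proof -
  interpret pair_graph T using tree by (simp add: undirected_tree_def)
  let ?E = "parcs T"
  have sym: "(y, x) \<in> ?E" if "(x, y) \<in> ?E" for x y using arcs_symmetric[OF that] .
  have irrefl: "(x, x) \<notin> ?E" for x using no_loops' by blast
  have dist: "distinct p" if "nb_walk ?E p" for p
  proof (rule nb_walk_distinct[OF irrefl _ that])
    fix q assume q: "edge_walk ?E q" "distinct q" "3 \<le> length q"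
    have "set q \<subseteq> pverts T"
    proof
      fix x assume "x \<in> set q"
      then obtain i where i: "i < length q" "x = q ! i" by (auto simp: in_set_conv_nth)
      show "x \<in> pverts T"
      proof (cases "Suc i < length q")
        case True
        then show ?thesis using successively_nthD[of _ q i] q(1) i in_arcsD1 by (auto simp: edge_walk_def)
      next
        case False
        then have "Suc (i - 1) < length q" "Suc (i - 1) = i" using i q(3) by simp_all
        then show ?thesis
          using successively_nthD[of "\<lambda>x y. (x, y) \<in> ?E" q "i - 1"] q(1) i in_arcsD2 by (auto simp: edge_walk_def)
      qed
    qed
    then have "vpath q (with_proj T)"
      using q by (auto simp: vpath_def vwalk_def edge_walk_def successively_iff_vwalk_arcs)
    then show "(last q, hd q) \<notin> ?E"
      using tree q(3) by (auto simp: undirected_tree_def undirected_cycle_def)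
  qed
  have uniq: "p = q" if "nb_walk ?E p" "nb_walk ?E q" "hd p = hd q" "last p = last q" for p q
    by (rule nb_walk_unique[OF sym dist that])
  have dist_le: "graph_dist T x y \<le> 4" if "x \<in> pverts T" "y \<in> pverts T" for x y
    unfolding diam[symmetric] diameter_def by (rule SUP_upper2[OF that(1)], rule SUP_upper[OF that(2)])
  have short: "length p \<le> 5" if "nb_walk ?E p" "hd p \<in> pverts T" "last p \<in> pverts T" for p
  proof -
    have "graph_dist T (hd p) (last p) < ereal (Suc 4)"
      using dist_le[OF that(2,3)] by (rule le_less_trans) simp
    then obtain q where "nb_walk ?E q" "hd q = hd p" "last q = last p" "length q \<le> Suc 4"
      by (rule graph_dist_lessD)
    then show ?thesis using uniq[OF that(1), of q] by simp
  qed
  have "\<exists>x\<in>pverts T. \<exists>y\<in>pverts T. \<not> graph_dist T x y \<le> 3"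
  proof (rule ccontr)
    assume "\<not> ?thesis"
    then have "diameter T \<le> 3" unfolding diameter_def by (intro SUP_least) auto
    then show False using diam by simp
  qed
  then obtain u v where uv: "u \<in> pverts T" "v \<in> pverts T" "\<not> graph_dist T u v \<le> 3" by blast
  have "graph_dist T u v < ereal (Suc 4)"
    using dist_le[OF uv(1,2)] by (rule le_less_trans) simp
  then obtain p where p: "nb_walk ?E p" "hd p = u" "last p = v" "length p \<le> Suc 4"
    by (rule graph_dist_lessD)
  have "\<not> length p \<le> Suc 3"
    using graph_dist_le[of p 3] p uv by (auto simp: nb_walk_def)
  then have "length p = 5" using p(4) by simp
  then obtain u' a c b v' where "p = [u', a, c, b, v']"
    by (auto simp: length_Suc_conv eval_nat_numeral)
  then have p: "nb_walk ?E [u, a, c, b, v]" using p by simp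
  have center: "x = c \<or> (c, x) \<in> ?E \<or> (\<exists>y. (c, y) \<in> ?E \<and> (y, x) \<in> ?E)" if "x \<in> pverts T" for x
  proof -
    let ?P = "\<lambda>x. x = c \<or> (c, x) \<in> ?E \<or> (\<exists>y. (c, y) \<in> ?E \<and> (y, x) \<in> ?E)"
    have c: "c \<in> pverts T" using p in_arcsD1[of c b] by simp
    have "c \<rightarrow>\<^sup>*\<^bsub>mk_symmetric (with_proj T)\<^esub> x"
      using tree that c
      by (auto simp: undirected_tree_def Digraph_Component.connected_def strongly_connected_def mk_symmetric_def)
    then have "c \<rightarrow>\<^sup>*\<^bsub>with_proj T\<^esub> x"
      using reachable_mk_symmetric_eq[OF sym_arcs] by simp
    then show "?P x"
    proof (induction rule: reachable_induct)
      case (step z x)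
      then have zx: "(z, x) \<in> ?E" by simp
      show ?case
      proof (rule ccontr)
        assume notP: "\<not> ?P x"
        then obtain y where y: "(c, y) \<in> ?E" "(y, z) \<in> ?E" "z \<noteq> c"
          using step.IH zx by blast
        have ne: "c \<noteq> z" "y \<noteq> x" using y notP by auto
        have V: "x \<in> pverts T" using zx in_arcsD2 by blast
        show False
        proof (cases "y = a")
          case False
          then have "nb_walk ?E [u, a, c, y, z, x]" using p y ne zx by simp
          then show False using short[of "[u, a, c, y, z, x]"] uv V by simp
        next
          case True
          then have "y \<noteq> b" "v \<noteq> c" using p by auto
          then have "nb_walk ?E [v, b, c, y, z, x]" using p y ne zx sym by simp
          then show False using short[of "[v, b, c, y, z, x]"] uv V by simp
        qed
      qed
    qed simp
  qed
  show thesis using that[OF p center dist] .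
qed

section \<open>Trees of diameter 4\<close>

text \<open>The enumeration lists the centre, its neighbours \<open>N\<close> and then the vertices
  \<open>W\<close> at distance 2. Acyclicity excludes edges within \<open>N\<close> and within
  \<open>W\<close> and makes the parent of a vertex in \<open>W\<close> unique.\<close>

lemma diameter_4_parent_enum:
  assumes tree: "undirected_tree T" and diam: "diameter T = 4"
  obtains vs par p k r where
    "parent_enum T vs par" "k < length vs" "2 \<le> r" "r \<le> k"
    "\<And>j. 0 < j \<Longrightarrow> j \<le> k \<Longrightarrow> par j = 0"
    "\<And>j. k < j \<Longrightarrow> j < length vs \<Longrightarrow> 0 < par j \<and> par j \<le> k"
    "\<And>j. j < k \<Longrightarrow> p j = card {l. k < l \<and> l < length vs \<and> par l = Suc j}"
    "\<And>i j. i \<le> j \<Longrightarrow> j < k \<Longrightarrow> p j \<le> p i"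
    "\<And>j. j < r \<Longrightarrow> 1 \<le> p j"
    "\<And>j. r \<le> j \<Longrightarrow> j < k \<Longrightarrow> p j = 0"
proof -
  interpret pair_graph T using tree by (simp add: undirected_tree_def)
  let ?E = "parcs T"
  obtain c a u b v where path: "nb_walk ?E [u, a, c, b, v]"
    and center: "\<And>x. x \<in> pverts T \<Longrightarrow> x = c \<or> (c, x) \<in> ?E \<or> (\<exists>y. (c, y) \<in> ?E \<and> (y, x) \<in> ?E)"
    and dist: "\<And>p. nb_walk ?E p \<Longrightarrow> distinct p"
    using diameter_4_center[OF tree diam] by metis
  have sym: "(x, y) \<in> ?E \<longleftrightarrow> (y, x) \<in> ?E" for x y using arcs_symmetric by blast
  have irrefl: "(x, x) \<notin> ?E" for x using no_loops' by blast
  define N where "N = {y. (c, y) \<in> ?E}"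
  define W where "W = {x \<in> pverts T. x \<noteq> c \<and> (c, x) \<notin> ?E}"
  define ch where "ch y = {x \<in> W. (y, x) \<in> ?E}" for y
  have V: "pverts T = insert c (N \<union> W)" "c \<notin> N" "c \<notin> W" "N \<inter> W = {}"
    using path in_arcsD1[of c b] in_arcsD2 irrefl by (auto simp: N_def W_def)
  then have fin: "finite N" "finite W" using pair_finite_verts by (auto intro: finite_subset)
  have WD: "x \<noteq> c" "(c, x) \<notin> ?E" "x \<in> pverts T" if "x \<in> W" for x using that by (auto simp: W_def)
  have ex_parent: "\<exists>y\<in>N. (y, x) \<in> ?E" if "x \<in> W" for x
    using center[of x] WD[OF that] by (auto simp: N_def)
  \<comment> \<open>Here and in the next facts, a forbidden edge would give a walk without
    backtracking that returns to its start, against \<open>dist\<close>.\<close>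
  have parent_unique: "y = y'" if "x \<in> W" "y \<in> N" "y' \<in> N" "(y, x) \<in> ?E" "(y', x) \<in> ?E" for x y y'
  proof (rule ccontr)
    assume "y \<noteq> y'"
    then have "nb_walk ?E [c, y, x, y', c]"
      using that WD[OF that(1)] sym by (simp add: N_def)
    then show False using dist by fastforce
  qed
  have NN: "(y, y') \<notin> ?E" if "y \<in> N" "y' \<in> N" for y y'
  proof
    assume "(y, y') \<in> ?E"
    then have "nb_walk ?E [c, y, y', c]"
      using that V(2) sym[of y' c] by (auto simp: N_def)
    then show False using dist by fastforce
  qed
  have WW: "(x, x') \<notin> ?E" if W: "x \<in> W" "x' \<in> W" for x x'
  proof
    assume xx': "(x, x') \<in> ?E"
    obtain y y' where y: "y \<in> N" "(y, x) \<in> ?E" "y' \<in> N" "(y', x') \<in> ?E"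
      using ex_parent[OF W(1)] ex_parent[OF W(2)] by blast
    have ne: "y \<noteq> x'" "x \<noteq> y'" "c \<noteq> x" "x' \<noteq> c" using y W V WD by auto
    show False
    proof (cases "y = y'")
      case True
      then have "nb_walk ?E [y, x, x', y]" using y xx' ne sym[of x' y] by simp
      then show False using dist by fastforce
    next
      case False
      then have "nb_walk ?E [c, y, x, x', y', c]"
        using y xx' ne sym[of x' y'] sym[of y' c] by (simp add: N_def)
      then show False using dist by fastforce
    qed
  qed
  have ab: "a \<in> N" "b \<in> N" "a \<noteq> b" "u \<in> ch a" "v \<in> ch b"
  proof -
    show "a \<in> N" "b \<in> N" "a \<noteq> b" using path sym[of a c] by (auto simp: N_def)
    have "(c, u) \<notin> ?E"
    proof
      assume "(c, u) \<in> ?E"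
      then have "nb_walk ?E [c, u, a, c]" using path irrefl by auto
      then show False using dist by fastforce
    qed
    then show "u \<in> ch a" using path sym[of u a] in_arcsD1[of u a] by (auto simp: ch_def W_def)
    have "(c, v) \<notin> ?E"
    proof
      assume "(c, v) \<in> ?E"
      then have "nb_walk ?E [c, b, v, c]" using path irrefl sym[of c v] by auto
      then show False using dist by fastforce
    qed
    then show "v \<in> ch b" using path in_arcsD2[of b v] by (auto simp: ch_def W_def)
  qed
  let ?f = "\<lambda>y. card (ch y)"
  obtain l0 where l0: "set l0 = N" "distinct l0" using finite_distinct_list[OF fin(1)] by blast
  obtain Wl where Wl: "set Wl = W" "distinct Wl" using finite_distinct_list[OF fin(2)] by blast
  \<comment> \<open>Descending numbers of leaves make the branch poles sorted and put the neighbours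
    without leaves last.\<close>
  define Nl where "Nl = rev (sort_key ?f l0)"
  have Nl: "set Nl = N" "distinct Nl" using l0 by (simp_all add: Nl_def)
  define k where "k = length Nl"
  define vs where "vs = c # Nl @ Wl"
  define p where "p j = ?f (Nl ! j)" for j
  have desc: "p j \<le> p i" if "i \<le> j" "j < k" for i j
  proof -
    have "sorted (rev (map ?f Nl))" by (simp add: Nl_def rev_map)
    then show ?thesis using sorted_rev_nth_mono[of "map ?f Nl" i j] that by (simp add: p_def k_def)
  qed
  have vs: "distinct vs" "set vs = pverts T" "k < length vs"
    using V Nl Wl by (auto simp: vs_def k_def)
  have vs0: "vs ! 0 = c" by (simp add: vs_def)
  have vsN: "vs ! Suc j = Nl ! j" "Nl ! j \<in> N" if "j < k" for j
    using that Nl nth_mem by (auto simp: vs_def k_def nth_append)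
  have vsW: "vs ! j \<in> W" if "k < j" "j < length vs" for j
  proof -
    have "vs ! j = Wl ! (j - Suc k)" "j - Suc k < length Wl"
      using that by (auto simp: vs_def k_def nth_append nth_Cons split: nat.split)
    then show ?thesis using Wl(1) nth_mem by metis
  qed
  define par where "par j = (if j \<le> k then 0 else Suc (SOME i. i < k \<and> (Nl ! i, vs ! j) \<in> ?E))" for j
  have par_low: "par j = 0" if "j \<le> k" for j using that by (simp add: par_def)
  have par_high: "\<exists>i<k. par j = Suc i \<and> (Nl ! i, vs ! j) \<in> ?E" if j: "k < j" "j < length vs" for j
  proof -
    obtain y where "y \<in> N" "(y, vs ! j) \<in> ?E" using ex_parent[OF vsW[OF j]] by blast
    then have "\<exists>i. i < k \<and> (Nl ! i, vs ! j) \<in> ?E" using Nl(1) by (metis in_set_conv_nth k_def)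
    from someI_ex[OF this] show ?thesis using j by (auto simp: par_def)
  qed
  have par_less: "par j < j" if "0 < j" "j < length vs" for j
    using par_low[of j] par_high[of j] that by (cases "j \<le> k") auto
  have edge: "(vs ! i, vs ! j) \<in> ?E \<longleftrightarrow> par j = i" if ij: "i < j" "j < length vs" for i j
  proof (cases "j \<le> k")
    case True
    then obtain j' where j': "j = Suc j'" "j' < k" using ij by (cases j) auto
    show ?thesis
    proof (cases i)
      case 0
      then show ?thesis using vs0 vsN[OF j'(2)] j' True par_low by (simp add: N_def)
    next
      case (Suc i')
      then have "i' < k" using ij True by simp
      then show ?thesis using Suc vsN[of i'] vsN[OF j'(2)] j' NN par_low[OF True] by simp
    qed
  next
    case False
    then have w: "vs ! j \<in> W" using vsW ij by simp
    obtain i0 where i0: "i0 < k" "par j = Suc i0" "(Nl ! i0, vs ! j) \<in> ?E"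
      using par_high[of j] False ij by auto
    consider "i = 0" | i' where "i = Suc i'" "i' < k" | "k < i" by (cases "i \<le> k"; cases i) auto
    then show ?thesis
    proof cases
      case 1
      then show ?thesis using vs0 WD[OF w] i0 by simp
    next
      case 2
      have "i' = i0" if "(Nl ! i', vs ! j) \<in> ?E"
      proof -
        have "Nl ! i' = Nl ! i0" using parent_unique[OF w] vsN(2) 2(2) i0 that by blast
        then show ?thesis using Nl(2) 2(2) i0(1) by (simp add: nth_eq_iff_index_eq k_def)
      qed
      then show ?thesis using 2 i0 vsN(1)[of i'] by auto
    next
      case 3
      then show ?thesis using WW[OF vsW w, of i] i0 ij by simp
    qed
  qed
  have pe: "parent_enum T vs par"
    unfolding parent_enum_def
  proof (intro conjI allI impI)
    show "parcs T \<subseteq> pverts T \<times> pverts T" using in_arcsD1 in_arcsD2 by auto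
    show "par j < j" if "0 < j \<and> j < length vs" for j using par_less that by blast
    show "(vs ! i, vs ! j) \<in> ?E \<longleftrightarrow> 0 < j \<and> par j = i \<or> 0 < i \<and> par i = j"
      if "i < length vs" "j < length vs" for i j
    proof -
      consider "i < j" | "i = j" | "j < i" by linarith
      then show ?thesis
      proof cases
        case 1
        then show ?thesis using edge[of i j] par_less[of i] that by (cases "i = 0") auto
      next
        case 2
        then show ?thesis using irrefl[of "vs ! j"] par_less[of j] that by (cases "j = 0") auto
      next
        case 3
        then show ?thesis using edge[of j i] par_less[of j] sym[of "vs ! i" "vs ! j"] that
          by (cases "j = 0") auto
      qed
    qed
  qed (use vs in auto)
  have p_card: "p j = card {l. k < l \<and> l < length vs \<and> par l = Suc j}" if j: "j < k" for j
  proof -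
    let ?L = "{l. k < l \<and> l < length vs \<and> par l = Suc j}"
    have "ch (Nl ! j) = (\<lambda>l. vs ! l) ` ?L"
    proof (intro equalityI subsetI)
      fix x assume "x \<in> ch (Nl ! j)"
      then have x: "x \<in> W" "(Nl ! j, x) \<in> ?E" by (auto simp: ch_def)
      then obtain l where l: "l < length vs" "x = vs ! l" using vs(2) WD(3) by (metis in_set_conv_nth)
      have "k < l"
      proof (rule ccontr)
        assume "\<not> k < l"
        then have "x = c \<or> x \<in> N" using l vs0 vsN by (cases l) auto
        then show False using x V by auto
      qed
      then have "par l = Suc j" using edge[of "Suc j" l] l x j vsN(1)[OF j] by simp
      then show "x \<in> (\<lambda>l. vs ! l) ` ?L" using l \<open>k < l\<close> by blast
    next
      fix x assume "x \<in> (\<lambda>l. vs ! l) ` ?L"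
      then obtain l where l: "k < l" "l < length vs" "par l = Suc j" "x = vs ! l" by blast
      then show "x \<in> ch (Nl ! j)"
        using edge[of "Suc j" l] vsW[of l] vsN(1)[OF j] j by (simp add: ch_def)
    qed
    moreover have "inj_on (\<lambda>l. vs ! l) ?L"
      using vs(1) by (auto simp: inj_on_def nth_eq_iff_index_eq)
    ultimately show ?thesis by (simp add: p_def card_image)
  qed
  \<comment> \<open>The alternative \<open>k \<le> j\<close> makes \<open>r = k\<close> if every
    neighbour of the centre carries leaves.\<close>
  define r where "r = (LEAST j. k \<le> j \<or> p j = 0)"
  have "k \<le> r \<or> p r = 0" unfolding r_def by (rule LeastI[of _ k]) simp
  have r_le: "r \<le> k" unfolding r_def by (rule Least_le) simp
  have low: "j < k \<and> p j \<noteq> 0" if "j < r" for j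
    using not_less_Least[of j "\<lambda>j. k \<le> j \<or> p j = 0"] that unfolding r_def by auto
  have zero: "p j = 0" if "r \<le> j" "j < k" for j
    using \<open>k \<le> r \<or> p r = 0\<close> desc[OF that] that by auto
  have r_ge: "2 \<le> r"
  proof -
    obtain i j where ij: "i < k" "j < k" "Nl ! i = a" "Nl ! j = b"
      using ab Nl(1) by (metis in_set_conv_nth k_def)
    have "finite (ch y)" for y using fin(2) by (simp add: ch_def)
    then have "p i \<noteq> 0" "p j \<noteq> 0" using ab ij by (auto simp: p_def)
    then have "i < r" "j < r" using zero ij by (meson linorder_not_less)+
    moreover have "i \<noteq> j" using ij ab by auto
    ultimately show ?thesis by simp
  qed
  have par_bounds: "0 < par j \<and> par j \<le> k" if "k < j" "j < length vs" for j
    using par_high[OF that] by auto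
  show thesis
  proof (rule that[OF pe vs(3) r_ge r_le])
    show "1 \<le> p j" if "j < r" for j using low[OF that] by simp
  qed (use par_low in simp, fact par_bounds, fact p_card, fact desc, fact zero)
qed

theorem theorem3p4:
  fixes T :: "'a pair_pre_digraph" and n :: nat
  assumes "undirected_tree T"
    and "card (pverts T) = n"
    and "diameter T = 4"
  shows "laplacian_energy (path_graph n) \<le> laplacian_energy T \<and>
         laplacian_energy T \<le> laplacian_energy (star_graph n)"
proof -
  obtain vs par p k r where T:
    "parent_enum T vs par" "k < length vs" "2 \<le> r" "r \<le> k"
    "\<And>j. 0 < j \<Longrightarrow> j \<le> k \<Longrightarrow> par j = 0"
    "\<And>j. k < j \<Longrightarrow> j < length vs \<Longrightarrow> 0 < par j \<and> par j \<le> k"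
    "\<And>j. j < k \<Longrightarrow> p j = card {l. k < l \<and> l < length vs \<and> par l = Suc j}"
    "\<And>i j. i \<le> j \<Longrightarrow> j < k \<Longrightarrow> p j \<le> p i"
    "\<And>j. j < r \<Longrightarrow> 1 \<le> p j"
    "\<And>j. r \<le> j \<Longrightarrow> j < k \<Longrightarrow> p j = 0"
    by (rule diameter_4_parent_enum[OF assms(1,3)]) blast
  obtain bs where bs:
    "length vs = 1 + k + (\<Sum>j<k. p j)"
    "interlaced bs (branch_poles p k)"
    "\<And>x. x \<notin> set (branch_poles p k) \<Longrightarrow>
       (\<Prod>b\<leftarrow>bs. x - b) = (\<Prod>a\<leftarrow>branch_poles p k. x - a) * secular p k x"
    "sum_list bs = 3 * real k + (\<Sum>j<k. p j)"
    "\<And>g :: real \<Rightarrow> real. (\<Sum>\<mu>\<in>#proots (char_poly (laplacian_mat T vs)). g \<mu>)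
       = (\<Sum>b\<leftarrow>bs. g b) + (real (\<Sum>j<k. p j) - k) * g 1"
    using diameter_4_spectrum[OF T(1,2,5-8)] by blast
  have n: "length vs = n"
    using parent_enumD(1,2)[OF T(1)] assms(2) by (metis distinct_card)
  interpret diameter_4_data p k n r bs
    using bs T n by unfold_locales auto
  have "vs \<noteq> []" using T(2) by auto
  then have "laplacian_energy T = energy"
    using parent_enum_laplacian_energy[OF T(1)] bs(5) n by (simp add: energy_def)
  then show ?thesis using energy_ge_path energy_le_star by simp
qed

end
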